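(* Let $(C,0)$ be a curve in $(\mathbb{C}^2,0)$. Then, unless the germ of $\{x=0\}$ at the origin is contained in $(C,0)$, there exist a positive integer $n$ and a holomorphic function germ $\phi:(\mathbb{C},0)\to(\mathbb{C},0)$ such that $x=t^n$, $y=\phi(t)$ is a parametric equation for $(C,0)$.
   Context: A curve $(C,0)$ in $(\mathbb{C}^2,0)$ is the set-germ at the origin of $f^{-1}(0)$, where $f:(\mathbb{C}^2,0)\to(\mathbb{C},0)$ is a nonzero holomorphic function germ. A parametric equation for a curve $(C,0)$ is a germ of an injective holomorphic mapping $\alpha:(\mathbb{C},0)\to(\mathbb{C}^2,0)$ whose image is contained in $(C,0)$ (a germ is injective if it has an injective representative). *)

theory Defs
  imports "HOL-Complex_Analysis.Complex_Analysis"
begin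

text \<open>
  Germs are handled through representatives. A set-germ at a point is given by any set
  representing it, and a function germ by any (total) function representing it. All notions
  below are invariant under changing the representative away from a neighbourhood of the point.
\<close>

definition germ_subset :: "'a::topological_space \<Rightarrow> 'a set \<Rightarrow> 'a set \<Rightarrow> bool" where
  "germ_subset a A B \<longleftrightarrow> (\<forall>\<^sub>F p in nhds a. p \<in> A \<longrightarrow> p \<in> B)"

definition germ_eq :: "'a::topological_space \<Rightarrow> 'a set \<Rightarrow> 'a set \<Rightarrow> bool" where
  "germ_eq a A B \<longleftrightarrow> (\<forall>\<^sub>F p in nhds a. p \<in> A \<longleftrightarrow> p \<in> B)"

text \<open>
  The derivative in the sense of \<^const>\<open>has_derivative\<close> is only real-linear. Requiring the form
  \<open>(h, k) \<mapsto> a h + b k\<close> with complex \<open>a\<close>, \<open>b\<close> makes it complex-linear.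
\<close>

definition holomorphic2_on ::
    "(complex \<times> complex \<Rightarrow> complex) \<Rightarrow> (complex \<times> complex) set \<Rightarrow> bool" where
  "holomorphic2_on f U \<longleftrightarrow>
     (\<forall>p\<in>U. \<exists>a b. (f has_derivative (\<lambda>(h, k). a * h + b * k)) (at p within U))"

definition holomorphic_germ2 :: "(complex \<times> complex \<Rightarrow> complex) \<Rightarrow> bool" where
  "holomorphic_germ2 f \<longleftrightarrow> (\<exists>U. open U \<and> 0 \<in> U \<and> holomorphic2_on f U)"

definition plane_curve_germ :: "(complex \<times> complex) set \<Rightarrow> bool" where
  "plane_curve_germ C \<longleftrightarrow>
     (\<exists>f. holomorphic_germ2 f \<and> f 0 = 0 \<and> \<not> (\<forall>\<^sub>F p in nhds 0. f p = 0) \<and>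
          germ_eq 0 C (f -` {0}))"

text \<open>The set \<open>V\<close> below is the domain of an injective representative of the germ of \<open>\<alpha>\<close>.\<close>

definition parametric_equation ::
    "(complex \<Rightarrow> complex \<times> complex) \<Rightarrow> (complex \<times> complex) set \<Rightarrow> bool" where
  "parametric_equation \<alpha> C \<longleftrightarrow>
     \<alpha> 0 = 0 \<and>
     (\<exists>V. open V \<and> 0 \<in> V \<and>
          (\<lambda>t. fst (\<alpha> t)) holomorphic_on V \<and> (\<lambda>t. snd (\<alpha> t)) holomorphic_on V \<and>
          inj_on \<alpha> V \<and> germ_subset 0 (\<alpha> ` V) C)"

end

theory Submission imports Defs begin

text \<open>
  The curve is \<open>f = 0\<close>. Since it does not contain the line \<open>x = 0\<close>, the function \<open>f (0, y)\<close> vanishes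
  at \<open>y = 0\<close> to a finite order \<open>m > 0\<close>. The heart of the matter is \<open>newton_puiseux\<close>: by induction
  on \<open>m\<close>, there are \<open>n > 0\<close> and a holomorphic germ \<open>\<psi>\<close> with \<open>\<psi> 0 = 0\<close> and \<open>f (t ^ n, \<psi> t) = 0\<close>.

  The induction is Newton's, carried out on holomorphic germs instead of formal power series, so
  that the solution it produces is holomorphic by construction. Two classical devices make the order
  drop at every step.

  \<^item> A Tschirnhaus shift. The derivative of \<open>f\<close> of order \<open>m - 1\<close> in \<open>y\<close>, restricted to the line
    \<open>x = 0\<close>, has a simple zero at \<open>0\<close>. By the implicit function theorem (\<open>implicit_function_germ\<close>) it
    vanishes on a graph \<open>y = c x\<close>. Expanding around this graph gives
    \<open>f (x, c x + y) = (\<Sum>j<m. a j x * y ^ j) + y ^ m * R (x, y)\<close> with \<open>a (m - 1) = 0\<close>, \<open>a j 0 = 0\<close> and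
    \<open>R 0 \<noteq> 0\<close>. If all \<open>a j\<close> vanish, then \<open>\<psi> = c\<close> is a solution.

  \<^item> A substitution \<open>x = u ^ p\<close>, \<open>y = u ^ q * z\<close> along the edge of the Newton polygon that ends at
    \<open>y ^ m\<close> (\<open>newton_slope\<close>). It makes \<open>u ^ (q * m)\<close> a common factor; after cancelling it, the value
    at \<open>u = 0\<close> is a polynomial in \<open>z\<close> of degree \<open>m\<close>, without a term of degree \<open>m - 1\<close>, and not a
    monomial. Such a polynomial has no root of multiplicity \<open>m\<close> (\<open>poly_root_multiplicity_less\<close>), so
    the new function has smaller order at any of its roots, and the induction hypothesis applies.

  Injectivity comes for free by choosing \<open>n\<close> minimal. Two parameters with the same image differ by an
  \<open>n\<close>-th root of unity \<open>\<zeta>\<close>. If this happened arbitrarily close to \<open>0\<close> for some \<open>\<zeta> \<noteq> 1\<close>, then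
  \<open>\<psi> (\<zeta> * t) = \<psi> t\<close> identically, so \<open>\<psi>\<close> would be a power series in \<open>t ^ d\<close>, where \<open>d > 1\<close> is the order
  of \<open>\<zeta>\<close>, and \<open>n\<close> could be replaced by \<open>n div d\<close> (\<open>puiseux_root_reduce\<close>).

  The remaining analytic input is a little two-variable theory, all of it obtained from Cauchy's
  formula in one variable: on a polydisc, holomorphy is the same as joint continuity with separate
  holomorphy. In this form it is easily seen to be inherited by derivatives in \<open>y\<close> and by quotients
  \<open>(F (x, y) - F (x, 0)) / y\<close>, whereas the definition by a total derivative suits compositions.
\<close>

section \<open>Integrals depending holomorphically on a parameter\<close>

text \<open>
  Cauchy's formula for the derivative, with the contour integral written out as an integral over
  \<open>[0, 1]\<close>. In that shape the library's results on parameter-dependent integrals over boxes apply.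
\<close>

lemma deriv_eq_circle_integral:
  fixes f :: "complex \<Rightarrow> complex"
  assumes "0 < r" "cball z r \<subseteq> U" "f holomorphic_on U" "w \<in> ball z r"
  shows "deriv f w = integral (cbox 0 1) (\<lambda>t. f (circlepath z r t) *
           (of_real r * exp (2 * of_real pi * \<i> * of_real t)) / (circlepath z r t - w)^2)"
proof -
  have "contour_integral (circlepath z r) (\<lambda>u. f u / (u - w)^2) = (2 * pi * \<i>) * deriv f w"
    using assms
    by (intro Cauchy_contour_integral_circlepath_2)
       (auto intro: holomorphic_on_imp_continuous_on holomorphic_on_subset[OF _ order.trans[OF ball_subset_cball]]
              elim: holomorphic_on_subset)
  moreover have "contour_integral (circlepath z r) (\<lambda>u. f u / (u - w)^2) =
     integral {0..1} (\<lambda>t. (2 * pi * \<i>) * (f (circlepath z r t) * (of_real r * exp (2 * of_real pi * \<i> * of_real t))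
           / (circlepath z r t - w)^2))"
    by (simp add: contour_integral_integral vector_derivative_circlepath algebra_simps)
  ultimately show ?thesis
    by (simp only: integral_mult_right cbox_interval) simp
qed

text \<open>
  By Cauchy's formula the derivative is locally an integral of \<open>F\<close> over a fixed circle against a
  continuous kernel, and such an integral depends continuously on all parameters.
\<close>

lemma continuous_on_deriv_param:
  fixes F :: "complex \<times> 'a::t2_space \<Rightarrow> complex"
  assumes U: "open U" and cont: "continuous_on (U \<times> T) F"
    and holo: "\<And>t. t \<in> T \<Longrightarrow> (\<lambda>x. F (x, t)) holomorphic_on U"
  shows "continuous_on (U \<times> T) (\<lambda>p. deriv (\<lambda>x. F (x, snd p)) (fst p))"
proof (unfold continuous_on_eq_continuous_within, intro ballI)
  fix p assume p: "p \<in> U \<times> T"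
  then obtain r where r: "0 < r" "cball (fst p) r \<subseteq> U"
    using U by (metis mem_Times_iff open_contains_cball)
  let ?z = "fst p" and ?B = "ball (fst p) r"
  define I where "I = (\<lambda>q. integral (cbox 0 1) (\<lambda>t::real. F (circlepath ?z r t, snd q) *
      (of_real r * exp (2 * of_real pi * \<i> * of_real t)) / (circlepath ?z r t - fst q)^2))"
  have circ: "circlepath ?z r t \<in> sphere ?z r" for t
    using r(1) unfolding circlepath by (simp add: dist_norm norm_mult)
  have circU: "circlepath ?z r t \<in> U" for t
    using circ[of t] r(2) sphere_cball[of ?z r] by (meson subsetD)
  have cI: "continuous_on (?B \<times> T) I"
    unfolding I_def
  proof (rule integral_continuous_on_param)
    have 1: "continuous_on ((?B \<times> T) \<times> cbox (0::real) 1) (\<lambda>y. F (circlepath ?z r (snd y), snd (fst y)))"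
    proof (rule continuous_on_compose2[OF cont])
      show "continuous_on ((?B \<times> T) \<times> cbox (0::real) 1) (\<lambda>y. (circlepath ?z r (snd y), snd (fst y)))"
        unfolding circlepath by (intro continuous_intros)
      show "(\<lambda>y. (circlepath ?z r (snd y), snd (fst y))) ` ((?B \<times> T) \<times> cbox (0::real) 1) \<subseteq> U \<times> T"
        using circU by auto
    qed
    have 2: "continuous_on ((?B \<times> T) \<times> cbox (0::real) 1)
        (\<lambda>y. of_real r * exp (2 * of_real pi * \<i> * of_real (snd y)) :: complex)"
      by (intro continuous_intros)
    have 3: "continuous_on ((?B \<times> T) \<times> cbox (0::real) 1) (\<lambda>y. (circlepath ?z r (snd y) - fst (fst y))^2)"
      unfolding circlepath by (intro continuous_intros)
    have 4: "\<forall>y\<in>(?B \<times> T) \<times> cbox (0::real) 1. (circlepath ?z r (snd y) - fst (fst y))^2 \<noteq> 0"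
    proof
      fix y assume "y \<in> (?B \<times> T) \<times> cbox (0::real) 1"
      then have "dist ?z (fst (fst y)) < r" by (simp add: mem_Times_iff)
      moreover have "dist ?z (circlepath ?z r (snd y)) = r" using circ by simp
      ultimately show "(circlepath ?z r (snd y) - fst (fst y))^2 \<noteq> 0" by force
    qed
    show "continuous_on ((?B \<times> T) \<times> cbox (0::real) 1)
      (\<lambda>(q, t). F (circlepath ?z r t, snd q) *
          (of_real r * exp (2 * of_real pi * \<i> * of_real t)) / (circlepath ?z r t - fst q)^2)"
      unfolding case_prod_beta
      by (rule continuous_on_divide[OF continuous_on_mult[OF 1 2] 3 4])
  qed
  have dI: "I q = deriv (\<lambda>x. F (x, snd q)) (fst q)" if "q \<in> ?B \<times> T" for q
    unfolding I_def
    by (rule deriv_eq_circle_integral[symmetric, OF r holo]) (use that in auto)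
  have "continuous_on (?B \<times> T) (\<lambda>q. deriv (\<lambda>x. F (x, snd q)) (fst q))"
    by (rule continuous_on_eq[OF cI dI])
  then have "continuous (at p within ?B \<times> T) (\<lambda>q. deriv (\<lambda>x. F (x, snd q)) (fst q))"
    unfolding continuous_on_eq_continuous_within
    by (rule bspec) (use p r(1) in \<open>simp add: mem_Times_iff\<close>)
  moreover have "at p within U \<times> T = at p within ?B \<times> T"
    using r(1) by (intro at_within_nhd[of _ "?B \<times> UNIV"])
       (use r(2) ball_subset_cball[of ?z r] in \<open>auto simp: mem_Times_iff open_Times\<close>)
  ultimately show "continuous (at p within U \<times> T) (\<lambda>q. deriv (\<lambda>x. F (x, snd q)) (fst q))"
    by simp
qed

text \<open>
  Differentiation under the integral sign. The continuity of the derivative in both variables, which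
  this requires, is automatic by \<open>continuous_on_deriv_param\<close>.
\<close>

lemma holomorphic_on_integral_param:
  fixes G :: "complex \<Rightarrow> 'b::euclidean_space \<Rightarrow> complex"
  assumes U: "open U" and cont: "continuous_on (U \<times> cbox a b) (\<lambda>(x, t). G x t)"
    and holo: "\<And>t. t \<in> cbox a b \<Longrightarrow> (\<lambda>x. G x t) holomorphic_on U"
  shows "(\<lambda>x. integral (cbox a b) (G x)) holomorphic_on U"
proof -
  have cd: "continuous_on (U \<times> cbox a b) (\<lambda>(x, t). deriv (\<lambda>x. G x t) x)"
    using continuous_on_deriv_param[OF U cont] holo by (simp add: case_prod_beta)
  have "(\<lambda>x. integral (cbox a b) (G x)) holomorphic_on ball x r" if "ball x r \<subseteq> U" for x r
  proof (rule leibniz_rule_holomorphic)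
    show "((\<lambda>x. G x t) has_field_derivative deriv (\<lambda>x. G x t) y) (at y within ball x r)"
      if "y \<in> ball x r" "t \<in> cbox a b" for y t
      using holo[OF that(2)] that(1) \<open>ball x r \<subseteq> U\<close> U
      by (meson has_field_derivative_at_within holomorphic_derivI subsetD)
    show "G y integrable_on cbox a b" if "y \<in> ball x r" for y
      using that \<open>ball x r \<subseteq> U\<close>
      by (intro integrable_continuous continuous_on_compose2[OF cont, where f = "Pair y", simplified]) 
         (auto intro!: continuous_intros)
    show "continuous_on (ball x r \<times> cbox a b) (\<lambda>(x, t). deriv (\<lambda>x. G x t) x)"
      using cd by (rule continuous_on_subset) (use that in auto)
  qed auto
  then have "(\<lambda>x. integral (cbox a b) (G x)) analytic_on U"
    unfolding analytic_on_def using U open_contains_ball by blast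
  then show ?thesis by (rule analytic_imp_holomorphic)
qed

section \<open>Separate and joint holomorphy\<close>

text \<open>
  A function with partial derivatives has a total derivative once one of the partial derivatives is
  jointly continuous. For a continuous, separately holomorphic function this continuity holds by
  \<open>continuous_on_deriv_param\<close>.
\<close>

lemma holomorphic2_on_if_separately:
  assumes U: "open U" and V: "open V" and cont: "continuous_on (U \<times> V) F"
    and h1: "\<And>y. y \<in> V \<Longrightarrow> (\<lambda>x. F (x, y)) holomorphic_on U"
    and h2: "\<And>x. x \<in> U \<Longrightarrow> (\<lambda>y. F (x, y)) holomorphic_on V"
  shows "continuous_on (U \<times> V) (\<lambda>p. deriv (\<lambda>y. F (fst p, y)) (snd p))"
    and "holomorphic2_on F (U \<times> V)"
proof -
  have swap: "continuous_on (V \<times> U) (\<lambda>q. F (prod.swap q))"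
    by (rule continuous_on_compose2[OF cont]) (auto simp: prod.swap_def intro!: continuous_intros)
  have "continuous_on (V \<times> U) (\<lambda>q. deriv (\<lambda>y. F (snd q, y)) (fst q))"
    using continuous_on_deriv_param[OF V swap] h2 by simp
  then have "continuous_on (U \<times> V) (\<lambda>p. (\<lambda>q. deriv (\<lambda>y. F (snd q, y)) (fst q)) (snd p, fst p))"
    by (rule continuous_on_compose2) (auto intro!: continuous_intros)
  then show cd: "continuous_on (U \<times> V) (\<lambda>p. deriv (\<lambda>y. F (fst p, y)) (snd p))"
    by simp
  show "holomorphic2_on F (U \<times> V)"
    unfolding holomorphic2_on_def
  proof safe
    fix x y assume xy: "x \<in> U" "y \<in> V"
    \<comment> \<open>The criterion for total derivatives needs a convex set in the second variable.\<close>
    obtain s where s: "s > 0" "ball y s \<subseteq> V" using V xy openE by blast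
    have "((\<lambda>(x, y). F (x, y)) has_derivative
             (\<lambda>(h, k). deriv (\<lambda>x. F (x, y)) x * h + blinfun_mult_right (deriv (\<lambda>y. F (x, y)) y) k))
            (at (x, y) within U \<times> ball y s)"
    proof (rule has_derivative_partialsI)
      show "((\<lambda>x. F (x, y)) has_derivative (*) (deriv (\<lambda>x. F (x, y)) x)) (at x within U)"
        by (rule has_derivative_at_withinI)
           (rule holomorphic_derivI[OF h1[OF xy(2)] U xy(1), unfolded has_field_derivative_def])
      show "((\<lambda>y. F (x', y)) has_derivative
               blinfun_apply (blinfun_mult_right (deriv (\<lambda>y. F (x', y)) y'))) (at y' within ball y s)"
        if "x' \<in> U" "y' \<in> ball y s" for x' y'
      proof (rule has_derivative_at_withinI)
        have "y' \<in> V" using that(2) s(2) by (rule subsetD[rotated])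
        then show "((\<lambda>y. F (x', y)) has_derivative
               blinfun_apply (blinfun_mult_right (deriv (\<lambda>y. F (x', y)) y'))) (at y')"
          using holomorphic_derivI[OF h2[OF that(1)] V] by (simp add: has_field_derivative_def)
      qed
      have "continuous_on (U \<times> ball y s) (\<lambda>(x, y). blinfun_mult_right (deriv (\<lambda>y. F (x, y)) y))"
        unfolding case_prod_beta
        by (intro bounded_linear.continuous_on[OF bounded_linear_blinfun_mult_right]
                  continuous_on_subset[OF cd]) (use s in auto)
      then show "continuous (at (x, y) within U \<times> ball y s)
                   (\<lambda>(x, y). blinfun_mult_right (deriv (\<lambda>y. F (x, y)) y))"
        using xy s(1) by (auto simp: continuous_on_eq_continuous_within)
    qed (use s in auto)
    then have "(F has_derivative (\<lambda>(h, k). deriv (\<lambda>x. F (x, y)) x * h + deriv (\<lambda>y. F (x, y)) y * k))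
            (at (x, y) within U \<times> ball y s)" by simp
    moreover have "at (x, y) within U \<times> ball y s = at (x, y) within U \<times> V"
      using s by (intro at_within_nhd[of _ "UNIV \<times> ball y s"]) (auto intro!: open_Times)
    ultimately show "\<exists>a b. (F has_derivative (\<lambda>(h, k). a * h + b * k)) (at (x, y) within U \<times> V)"
      by auto
  qed
qed

lemma holomorphic_germ2_iff_eventually:
  "holomorphic_germ2 F \<longleftrightarrow>
     (\<forall>\<^sub>F p in nhds 0. \<exists>a b. (F has_derivative (\<lambda>(h, k). a * h + b * k)) (at p))"
proof -
  have "(\<exists>a b. (F has_derivative (\<lambda>(h, k). a * h + b * k)) (at p within U)) \<longleftrightarrow>
        (\<exists>a b. (F has_derivative (\<lambda>(h, k). a * h + b * k)) (at p))" if "open U" "p \<in> U" for p U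
    by (simp only: at_within_open[OF that(2,1)])
  then show ?thesis
    unfolding holomorphic_germ2_def holomorphic2_on_def eventually_nhds by meson
qed

lemma analytic_at_iff_eventually:
  "f analytic_on {z} \<longleftrightarrow> (\<forall>\<^sub>F x in nhds z. f field_differentiable at x)"
proof -
  have "f field_differentiable at x within U \<longleftrightarrow> f field_differentiable at x" if "open U" "x \<in> U" for x U
    by (simp only: at_within_open[OF that(2,1)])
  then show ?thesis
    unfolding analytic_at eventually_nhds holomorphic_on_def by meson
qed

lemma has_derivative_slices:
  assumes "(F has_derivative (\<lambda>(h, k). a * h + b * k)) (at (x, y))"
  shows "((\<lambda>x. F (x, y)) has_field_derivative a) (at x)"
    and "((\<lambda>y. F (x, y)) has_field_derivative b) (at y)"
proof -
  have "((\<lambda>x. F (x, y)) has_derivative (\<lambda>h. (case (h, 0) of (h, k) \<Rightarrow> a * h + b * k))) (at x)"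
    by (rule has_derivative_compose[where f = "\<lambda>x. (x, y)" and g = F, OF _ assms])
       (auto intro!: derivative_eq_intros)
  then show "((\<lambda>x. F (x, y)) has_field_derivative a) (at x)"
    by (simp add: has_field_derivative_def)
  have "((\<lambda>y. F (x, y)) has_derivative (\<lambda>k. (case (0, k) of (h, k) \<Rightarrow> a * h + b * k))) (at y)"
    by (rule has_derivative_compose[where f = "\<lambda>y. (x, y)" and g = F, OF _ assms])
       (auto intro!: derivative_eq_intros)
  then show "((\<lambda>y. F (x, y)) has_field_derivative b) (at y)"
    by (simp add: has_field_derivative_def)
qed

lemma holomorphic_germ2_iff_separately:
  "holomorphic_germ2 F \<longleftrightarrow>
     (\<exists>r>0. continuous_on (ball 0 r \<times> ball 0 r) F \<and>
        (\<forall>y\<in>ball 0 r. (\<lambda>x. F (x, y)) holomorphic_on ball 0 r) \<and>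
        (\<forall>x\<in>ball 0 r. (\<lambda>y. F (x, y)) holomorphic_on ball 0 r))" (is "_ \<longleftrightarrow> ?R")
proof
  assume "holomorphic_germ2 F"
  define D where "D p \<longleftrightarrow> (\<exists>a b. (F has_derivative (\<lambda>(h, k). a * h + b * k)) (at p))" for p
  have "\<forall>\<^sub>F p in nhds 0. D p"
    using \<open>holomorphic_germ2 F\<close> unfolding holomorphic_germ2_iff_eventually D_def .
  then obtain U where U: "open U" "0 \<in> U" "\<And>p. p \<in> U \<Longrightarrow> D p"
    unfolding eventually_nhds by blast
  obtain A B where AB: "open A" "open B" "0 \<in> A" "0 \<in> B" "A \<times> B \<subseteq> U"
    using open_prod_elim[OF U(1,2)] by (metis mem_Sigma_iff zero_prod_def)
  obtain r where r: "r > 0" "ball 0 r \<subseteq> A \<inter> B"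
    using AB by (metis IntI open_Int open_contains_ball)
  have sub: "(x, y) \<in> U" if "x \<in> ball 0 r" "y \<in> ball 0 r" for x y
    using that r(2) AB(5) by (meson IntD1 IntD2 SigmaI subsetD)
  have contF: "isCont F p" if "p \<in> U" for p
    using U(3)[OF that] unfolding D_def by (elim exE) (rule has_derivative_continuous)
  have slice1: "(\<lambda>x. F (x, y)) field_differentiable at x" if "(x, y) \<in> U" for x y
    using U(3)[OF that] unfolding D_def field_differentiable_def
    by (elim exE) (rule exI, erule has_derivative_slices)
  have slice2: "(\<lambda>y. F (x, y)) field_differentiable at y" if "(x, y) \<in> U" for x y
    using U(3)[OF that] unfolding D_def field_differentiable_def
    by (elim exE) (rule exI, erule has_derivative_slices)
  have "continuous_on (ball 0 r \<times> ball 0 r) F"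
  proof (rule continuous_at_imp_continuous_on, rule ballI)
    fix p :: "complex \<times> complex" assume "p \<in> ball 0 r \<times> ball 0 r"
    then have "p \<in> U" using sub[of "fst p" "snd p"] by (simp add: mem_Times_iff)
    then show "isCont F p" by (rule contF)
  qed
  moreover have "(\<lambda>x. F (x, y)) holomorphic_on ball 0 r" if y: "y \<in> ball 0 r" for y
    unfolding holomorphic_on_def
    by (rule ballI, rule field_differentiable_at_within, rule slice1, rule sub[OF _ y])
  moreover have "(\<lambda>y. F (x, y)) holomorphic_on ball 0 r" if x: "x \<in> ball 0 r" for x
    unfolding holomorphic_on_def
    by (rule ballI, rule field_differentiable_at_within, rule slice2, rule sub[OF x])
  ultimately show ?R
    using r(1) by (intro exI[of _ r] conjI ballI) simp_all
next
  assume ?R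
  then show "holomorphic_germ2 F"
  proof (elim exE conjE)
    fix r :: real
    assume r: "r > 0" "continuous_on (ball 0 r \<times> ball 0 r) F"
      "\<forall>y\<in>ball 0 r. (\<lambda>x. F (x, y)) holomorphic_on ball 0 r"
      "\<forall>x\<in>ball 0 r. (\<lambda>y. F (x, y)) holomorphic_on ball 0 r"
    have "holomorphic2_on F (ball 0 r \<times> ball 0 r)"
      by (rule holomorphic2_on_if_separately(2)[OF open_ball open_ball r(2) bspec[OF r(3)] bspec[OF r(4)]])
    moreover have "open (ball (0::complex) r \<times> ball (0::complex) r)"
      by (intro open_Times open_ball)
    moreover have "0 \<in> ball (0::complex) r \<times> ball (0::complex) r"
      using r(1) by (simp add: zero_prod_def)
    ultimately show "holomorphic_germ2 F"
      unfolding holomorphic_germ2_def by (intro exI conjI)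
  qed
qed

lemma holomorphic_germ2_separatelyE:
  assumes "holomorphic_germ2 F"
  obtains r where "r > 0" "continuous_on (ball 0 r \<times> ball 0 r) F"
      "\<And>y. y \<in> ball 0 r \<Longrightarrow> (\<lambda>x. F (x, y)) holomorphic_on ball 0 r"
      "\<And>x. x \<in> ball 0 r \<Longrightarrow> (\<lambda>y. F (x, y)) holomorphic_on ball 0 r"
  using assms unfolding holomorphic_germ2_iff_separately
proof (elim exE conjE)
  fix r :: real
  assume r: "r > 0" "continuous_on (ball 0 r \<times> ball 0 r) F"
    "\<forall>y\<in>ball 0 r. (\<lambda>x. F (x, y)) holomorphic_on ball 0 r"
    "\<forall>x\<in>ball 0 r. (\<lambda>y. F (x, y)) holomorphic_on ball 0 r"
  show thesis
    by (rule that[OF r(1,2) bspec[OF r(3)] bspec[OF r(4)]])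
qed

section \<open>Derivative and quotient in the second variable\<close>

definition deriv_snd :: "(complex \<times> complex \<Rightarrow> complex) \<Rightarrow> complex \<times> complex \<Rightarrow> complex" where
  "deriv_snd F = (\<lambda>p. deriv (\<lambda>y. F (fst p, y)) (snd p))"

text \<open>
  The only claim that is not immediate is holomorphy in \<open>x\<close>: the derivative in \<open>y\<close> is an integral of
  \<open>F (x, w)\<close> over a circle of points \<open>w\<close>, and the integrand is holomorphic in \<open>x\<close>.
\<close>

lemma deriv_snd_separately:
  assumes cont: "continuous_on (ball 0 r \<times> ball 0 r) F"
    and h1: "\<And>y. y \<in> ball 0 r \<Longrightarrow> (\<lambda>x. F (x, y)) holomorphic_on ball 0 r"
    and h2: "\<And>x. x \<in> ball 0 r \<Longrightarrow> (\<lambda>y. F (x, y)) holomorphic_on ball 0 r"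
  shows "continuous_on (ball 0 r \<times> ball 0 r) (deriv_snd F)"
    and "\<And>y. y \<in> ball 0 r \<Longrightarrow> (\<lambda>x. deriv_snd F (x, y)) holomorphic_on ball 0 r"
    and "\<And>x. x \<in> ball 0 r \<Longrightarrow> (\<lambda>y. deriv_snd F (x, y)) holomorphic_on ball 0 r"
proof -
  show "continuous_on (ball 0 r \<times> ball 0 r) (deriv_snd F)"
    unfolding deriv_snd_def using holomorphic2_on_if_separately(1)[OF _ _ cont h1 h2] by simp
  show "(\<lambda>y. deriv_snd F (x, y)) holomorphic_on ball 0 r" if "x \<in> ball 0 r" for x
    using holomorphic_deriv[OF h2[OF that]] by (simp add: deriv_snd_def)
  show "(\<lambda>x. deriv_snd F (x, y)) holomorphic_on ball 0 r" if y: "y \<in> ball 0 r" for y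
  proof -
    obtain s where s: "s > 0" "cball y s \<subseteq> ball 0 r"
      using y open_contains_cball open_ball by metis
    define K where "K = (\<lambda>t. (of_real s * exp (2 * of_real pi * \<i> * of_real t)) / (circlepath y s t - y)^2)"
    have dist: "dist y (circlepath y s t) = s" for t
      using s(1) by (simp add: circlepath dist_norm norm_mult)
    then have ne: "circlepath y s t - y \<noteq> 0" for t
      using s(1) by (metis dist_self eq_iff_diff_eq_0 less_irrefl)
    have circ: "circlepath y s t \<in> ball 0 r" for t
      using dist[of t] by (intro subsetD[OF s(2)]) simp
    have contK: "continuous_on (cbox 0 1) K"
      unfolding K_def
    proof (rule continuous_on_divide)
      show "\<forall>t\<in>cbox 0 1. (circlepath y s t - y)^2 \<noteq> 0" using ne by simp
      show "continuous_on (cbox 0 1) (\<lambda>t. (circlepath y s t - y)^2)"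
        unfolding circlepath by (intro continuous_intros)
    qed (intro continuous_intros)
    have dF: "integral (cbox 0 1) (\<lambda>t. F (x, circlepath y s t) * K t) = deriv_snd F (x, y)"
      if "x \<in> ball 0 r" for x
      unfolding deriv_snd_def K_def using deriv_eq_circle_integral[OF s h2[OF that], of y] s(1)
      by simp
    have "(\<lambda>x. integral (cbox 0 1) (\<lambda>t. F (x, circlepath y s t) * K t)) holomorphic_on ball 0 r"
    proof (rule holomorphic_on_integral_param)
      have "continuous_on (ball 0 r \<times> cbox (0::real) 1) (\<lambda>z. F (fst z, circlepath y s (snd z)))"
      proof (rule continuous_on_compose2[OF cont])
        show "continuous_on (ball 0 r \<times> cbox (0::real) 1) (\<lambda>z. (fst z, circlepath y s (snd z)))"
          unfolding circlepath by (intro continuous_intros)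
        show "(\<lambda>z. (fst z, circlepath y s (snd z))) ` (ball 0 r \<times> cbox (0::real) 1)
                \<subseteq> ball 0 r \<times> ball 0 r"
          using circ by auto
      qed
      moreover have "continuous_on (ball (0::complex) r \<times> cbox (0::real) 1) (\<lambda>z. K (snd z))"
        by (rule continuous_on_compose2[OF contK continuous_on_snd[OF continuous_on_id]]) auto
      ultimately show "continuous_on (ball 0 r \<times> cbox 0 1) (\<lambda>(x, t). F (x, circlepath y s t) * K t)"
        unfolding case_prod_beta by (rule continuous_on_mult)
      show "(\<lambda>x. F (x, circlepath y s t) * K t) holomorphic_on ball 0 r" for t
        by (intro holomorphic_on_mult h1 circ holomorphic_on_const)
    qed simp
    then show ?thesis
      by (rule holomorphic_transform) (rule dF)
  qed
qed

lemma holomorphic_germ2_deriv_snd: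
  assumes "holomorphic_germ2 F" shows "holomorphic_germ2 (deriv_snd F)"
proof -
  obtain r where r: "r > 0" "continuous_on (ball 0 r \<times> ball 0 r) F"
      "\<And>y. y \<in> ball 0 r \<Longrightarrow> (\<lambda>x. F (x, y)) holomorphic_on ball 0 r"
      "\<And>x. x \<in> ball 0 r \<Longrightarrow> (\<lambda>y. F (x, y)) holomorphic_on ball 0 r" 
    using holomorphic_germ2_separatelyE[OF assms] by metis
  show ?thesis
    unfolding holomorphic_germ2_iff_separately
    by (intro exI[of _ r] conjI ballI r(1) deriv_snd_separately[OF r(2-4)])
qed

text \<open>
  Hadamard's lemma: the quotient is the average of the derivative in \<open>y\<close> over the segment from
  \<open>(x, 0)\<close> to \<open>(x, y)\<close>. This formula also covers \<open>y = 0\<close>, so no removable singularity arises.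
\<close>

lemma holomorphic_germ2_divide_snd:
  assumes "holomorphic_germ2 F"
  obtains G where "holomorphic_germ2 G"
    "\<forall>\<^sub>F p in nhds 0. F p = F (fst p, 0) + snd p * G p"
proof -
  obtain r where r: "r > 0" "continuous_on (ball 0 r \<times> ball 0 r) F"
      "\<And>y. y \<in> ball 0 r \<Longrightarrow> (\<lambda>x. F (x, y)) holomorphic_on ball 0 r"
      "\<And>x. x \<in> ball 0 r \<Longrightarrow> (\<lambda>y. F (x, y)) holomorphic_on ball 0 r" 
    using holomorphic_germ2_separatelyE[OF assms] by metis
  note D = deriv_snd_separately[OF r(2-4)]
  define G where "G = (\<lambda>p. integral (cbox 0 1) (\<lambda>t::real. deriv_snd F (fst p, of_real t * snd p)))"
  have ball: "of_real t * y \<in> ball 0 r" if "t \<in> cbox 0 1" "y \<in> ball 0 r" for t and y :: complex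
  proof -
    have "\<bar>t\<bar> * norm y \<le> 1 * norm y" using that by (intro mult_right_mono) auto
    then show ?thesis using that by (simp add: norm_mult)
  qed
  have cont: "continuous_on ((ball 0 r \<times> ball 0 r) \<times> cbox (0::real) 1)
      (\<lambda>(p, t). deriv_snd F (fst p, of_real t * snd p))"
    unfolding case_prod_beta
    by (rule continuous_on_compose2[OF D(1)]) (use ball in \<open>auto intro!: continuous_intros\<close>)
  have germG: "holomorphic_germ2 G"
    unfolding holomorphic_germ2_iff_separately
  proof (intro exI[of _ r] conjI ballI r(1))
    show "continuous_on (ball 0 r \<times> ball 0 r) G"
      unfolding G_def by (rule integral_continuous_on_param[OF cont])
  next
    fix y :: complex assume y: "y \<in> ball 0 r"
    show "(\<lambda>x. G (x, y)) holomorphic_on ball 0 r"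
      unfolding G_def fst_conv snd_conv
    proof (rule holomorphic_on_integral_param)
      show "continuous_on (ball 0 r \<times> cbox (0::real) 1) (\<lambda>(x, t). deriv_snd F (x, of_real t * y))"
        unfolding case_prod_beta
        by (rule continuous_on_compose2[OF D(1)]) (use ball y in \<open>auto intro!: continuous_intros\<close>)
    qed (use ball y D(2) in auto)
  next
    fix x :: complex assume x: "x \<in> ball 0 r"
    show "(\<lambda>y. G (x, y)) holomorphic_on ball 0 r"
      unfolding G_def fst_conv snd_conv
    proof (rule holomorphic_on_integral_param)
      show "continuous_on (ball 0 r \<times> cbox (0::real) 1) (\<lambda>(y, t). deriv_snd F (x, of_real t * y))"
        unfolding case_prod_beta
        by (rule continuous_on_compose2[OF D(1)]) (use ball x in \<open>auto intro!: continuous_intros\<close>)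
      show "(\<lambda>y. deriv_snd F (x, of_real t * y)) holomorphic_on ball 0 r" if "t \<in> cbox 0 1" for t
        by (rule holomorphic_on_compose_gen[OF _ D(3), unfolded o_def])
           (use ball x that in \<open>auto intro!: holomorphic_intros\<close>)
    qed auto
  qed
  have "F (x, y) = F (x, 0) + y * G (x, y)" if x: "x \<in> ball 0 r" and y: "y \<in> ball 0 r" for x y
  proof -
    have "((\<lambda>t::real. F (x, of_real t * y)) has_vector_derivative
              y * deriv_snd F (x, of_real t * y)) (at t within {0..1})" if "t \<in> {0..1}" for t
    proof -
      have "((\<lambda>y. F (x, y)) has_field_derivative deriv_snd F (x, of_real t * y)) (at (of_real t * y))"
        unfolding deriv_snd_def fst_conv snd_conv
        using ball[of t y] that x y by (intro holomorphic_derivI[OF r(4)]) auto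
      then have "((\<lambda>w. F (x, w * y)) has_field_derivative deriv_snd F (x, of_real t * y) * y) (at (of_real t))"
        by (rule DERIV_chain2) (auto intro!: derivative_eq_intros)
      then show ?thesis
        using has_vector_derivative_real_field[of "\<lambda>w. F (x, w * y)"] 
        by (simp add: mult.commute)
    qed
    then have "((\<lambda>t::real. y * deriv_snd F (x, of_real t * y)) has_integral
                 F (x, of_real 1 * y) - F (x, of_real 0 * y)) {0..1}"
      by (intro fundamental_theorem_of_calculus) auto
    from integral_unique[OF this] show ?thesis by (simp add: G_def)
  qed
  then have "\<forall>p\<in>ball 0 r \<times> ball 0 r. F p = F (fst p, 0) + snd p * G p"
    by (simp add: mem_Times_iff)
  moreover have "open (ball (0::complex) r \<times> ball (0::complex) r)"
    by (intro open_Times open_ball)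
  moreover have "0 \<in> ball (0::complex) r \<times> ball (0::complex) r"
    using r(1) by (simp add: zero_prod_def)
  ultimately have "\<forall>\<^sub>F p in nhds 0. F p = F (fst p, 0) + snd p * G p"
    unfolding eventually_nhds by (intro exI conjI)
  with germG show thesis by (rule that)
qed

section \<open>The algebra of holomorphic germs in two variables\<close>

text \<open>
  Complex differentiability at a single point, so that holomorphic germs are the functions which have
  this property eventually. Closure properties then reduce to the pointwise rules of differentiation.
\<close>

definition complex_differentiable2 :: "(complex \<times> complex \<Rightarrow> complex) \<Rightarrow> complex \<times> complex \<Rightarrow> bool" where
  "complex_differentiable2 F p \<longleftrightarrow> (\<exists>a b. (F has_derivative (\<lambda>z. a * fst z + b * snd z)) (at p))"

lemma complex_differentiable2I:
  assumes "(F has_derivative D) (at p)" "\<And>z. D z = a * fst z + b * snd z"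
  shows "complex_differentiable2 F p"
proof -
  have "D = (\<lambda>z. a * fst z + b * snd z)" using assms(2) by auto
  with assms(1) show ?thesis unfolding complex_differentiable2_def by metis
qed

lemma complex_differentiable2E:
  assumes "complex_differentiable2 F p"
  obtains a b where "(F has_derivative (\<lambda>z. a * fst z + b * snd z)) (at p)"
  using assms unfolding complex_differentiable2_def by metis

lemma holomorphic_germ2_iff:
  "holomorphic_germ2 F \<longleftrightarrow> (\<forall>\<^sub>F p in nhds 0. complex_differentiable2 F p)"
  unfolding holomorphic_germ2_iff_eventually complex_differentiable2_def case_prod_beta ..

lemma complex_differentiable2_add:
  assumes "complex_differentiable2 F p" "complex_differentiable2 G p"
  shows "complex_differentiable2 (\<lambda>p. F p + G p) p"
proof -
  obtain a b where F: "(F has_derivative (\<lambda>z. a * fst z + b * snd z)) (at p)"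
    using assms(1) by (rule complex_differentiable2E)
  obtain c d where G: "(G has_derivative (\<lambda>z. c * fst z + d * snd z)) (at p)"
    using assms(2) by (rule complex_differentiable2E)
  show ?thesis
    by (rule complex_differentiable2I[OF has_derivative_add[OF F G], where a = "a + c" and b = "b + d"])
       (simp add: algebra_simps)
qed

lemma complex_differentiable2_mult:
  assumes "complex_differentiable2 F p" "complex_differentiable2 G p"
  shows "complex_differentiable2 (\<lambda>p. F p * G p) p"
proof -
  obtain a b where F: "(F has_derivative (\<lambda>z. a * fst z + b * snd z)) (at p)"
    using assms(1) by (rule complex_differentiable2E)
  obtain c d where G: "(G has_derivative (\<lambda>z. c * fst z + d * snd z)) (at p)"
    using assms(2) by (rule complex_differentiable2E)
  show ?thesis
    by (rule complex_differentiable2I[OF has_derivative_mult[OF F G],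
          where a = "F p * c + a * G p" and b = "F p * d + b * G p"]) (simp add: algebra_simps)
qed

lemma complex_differentiable2_compose:
  assumes "complex_differentiable2 F (g p, h p)" "complex_differentiable2 g p" "complex_differentiable2 h p"
  shows "complex_differentiable2 (\<lambda>p. F (g p, h p)) p"
proof -
  obtain a b where F: "(F has_derivative (\<lambda>z. a * fst z + b * snd z)) (at (g p, h p))"
    using assms(1) by (rule complex_differentiable2E)
  obtain c d where g: "(g has_derivative (\<lambda>z. c * fst z + d * snd z)) (at p)"
    using assms(2) by (rule complex_differentiable2E)
  obtain c' d' where h: "(h has_derivative (\<lambda>z. c' * fst z + d' * snd z)) (at p)"
    using assms(3) by (rule complex_differentiable2E)
  show ?thesis
    by (rule complex_differentiable2I[OF has_derivative_compose[OF has_derivative_Pair[OF g h] F],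
          where a = "a * c + b * c'" and b = "a * d + b * d'"]) (simp add: algebra_simps)
qed

lemma holomorphic_germ2_continuous:
  assumes "holomorphic_germ2 F"
  shows "\<forall>\<^sub>F p in nhds 0. isCont F p"
  using assms unfolding holomorphic_germ2_iff
  by (rule eventually_mono) (auto elim!: complex_differentiable2E dest: has_derivative_continuous)

lemma holomorphic_germ2_tendsto:
  assumes "holomorphic_germ2 F"
  shows "(F \<longlongrightarrow> F 0) (nhds 0)"
  using holomorphic_germ2_continuous[OF assms, THEN eventually_nhds_x_imp_x]
  by (simp add: isCont_def tendsto_at_iff_tendsto_nhds)

lemma holomorphic_germ2_const: "holomorphic_germ2 (\<lambda>p. c)"
  unfolding holomorphic_germ2_iff
  by (intro always_eventually allI, rule complex_differentiable2I[where a = 0 and b = 0], rule has_derivative_const) simp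

lemma holomorphic_germ2_fst: "holomorphic_germ2 fst"
  unfolding holomorphic_germ2_iff
  by (intro always_eventually allI, rule complex_differentiable2I[where a = 1 and b = 0], rule has_derivative_fst, rule has_derivative_ident) simp

lemma holomorphic_germ2_snd: "holomorphic_germ2 snd"
  unfolding holomorphic_germ2_iff
  by (intro always_eventually allI, rule complex_differentiable2I[where a = 0 and b = 1], rule has_derivative_snd, rule has_derivative_ident) simp

lemma holomorphic_germ2_add:
  assumes "holomorphic_germ2 F" "holomorphic_germ2 G"
  shows "holomorphic_germ2 (\<lambda>p. F p + G p)"
  using assms unfolding holomorphic_germ2_iff
  by (rule eventually_elim2) (rule complex_differentiable2_add)

lemma holomorphic_germ2_mult:
  assumes "holomorphic_germ2 F" "holomorphic_germ2 G"
  shows "holomorphic_germ2 (\<lambda>p. F p * G p)"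
  using assms unfolding holomorphic_germ2_iff
  by (rule eventually_elim2) (rule complex_differentiable2_mult)

lemma holomorphic_germ2_power:
  assumes "holomorphic_germ2 F"
  shows "holomorphic_germ2 (\<lambda>p. F p ^ n)"
  by (induction n) (simp_all add: holomorphic_germ2_const holomorphic_germ2_mult assms)

lemma holomorphic_germ2_sum:
  assumes "\<And>i. i \<in> I \<Longrightarrow> holomorphic_germ2 (F i)"
  shows "holomorphic_germ2 (\<lambda>p. \<Sum>i\<in>I. F i p)"
  using assms
  by (induction I rule: infinite_finite_induct) (simp_all add: holomorphic_germ2_const holomorphic_germ2_add)

lemma holomorphic_germ2_compose:
  assumes "holomorphic_germ2 F" "holomorphic_germ2 g" "holomorphic_germ2 h" "g 0 = 0" "h 0 = 0"
  shows "holomorphic_germ2 (\<lambda>p. F (g p, h p))"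
proof -
  have "((\<lambda>p. (g p, h p)) \<longlongrightarrow> (g 0, h 0)) (nhds 0)"
    by (intro tendsto_Pair holomorphic_germ2_tendsto assms)
  then have "filterlim (\<lambda>p. (g p, h p)) (nhds 0) (nhds 0)"
    using assms(4,5) by (simp add: zero_prod_def)
  with assms(1) have "\<forall>\<^sub>F p in nhds 0. complex_differentiable2 F (g p, h p)"
    unfolding holomorphic_germ2_iff by (rule eventually_compose_filterlim)
  then show ?thesis
    using assms(2,3) unfolding holomorphic_germ2_iff
    by eventually_elim (rule complex_differentiable2_compose)
qed

lemma holomorphic_germ2_analytic_fst:
  assumes "A analytic_on {0}"
  shows "holomorphic_germ2 (\<lambda>p. A (fst p))"
proof -
  have "filterlim fst (nhds (0::complex)) (nhds (0 :: complex \<times> complex))"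
    using holomorphic_germ2_tendsto[OF holomorphic_germ2_fst] by simp
  with assms have "\<forall>\<^sub>F p in nhds (0 :: complex \<times> complex). A field_differentiable at (fst p)"
    unfolding analytic_at_iff_eventually by (rule eventually_compose_filterlim)
  then show ?thesis
    unfolding holomorphic_germ2_iff
  proof eventually_elim
    case (elim p)
    then obtain a where "(A has_derivative (*) a) (at (fst p))"
      unfolding field_differentiable_def has_field_derivative_def by metis
    from has_derivative_compose[OF has_derivative_fst[OF has_derivative_ident] this]
    show ?case by (rule complex_differentiable2I[where a = a and b = 0]) simp
  qed
qed

lemma holomorphic_germ2_slice_fst:
  assumes "holomorphic_germ2 F"
  shows "(\<lambda>x. F (x, 0)) analytic_on {0}"
proof -
  obtain r where r: "r > 0" "\<And>y. y \<in> ball 0 r \<Longrightarrow> (\<lambda>x. F (x, y)) holomorphic_on ball 0 r"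
    using holomorphic_germ2_separatelyE[OF assms] by metis
  show ?thesis
    unfolding analytic_at using r(1) r(2)[of 0] by (intro exI[of _ "ball 0 r"] conjI) simp_all
qed

lemma holomorphic_germ2_slice_snd:
  assumes "holomorphic_germ2 F"
  shows "\<forall>\<^sub>F x in nhds 0. (\<lambda>y. F (x, y)) analytic_on {0}"
proof -
  obtain r where r: "r > 0" "\<And>x. x \<in> ball 0 r \<Longrightarrow> (\<lambda>y. F (x, y)) holomorphic_on ball 0 r"
    using holomorphic_germ2_separatelyE[OF assms] by metis
  have "(\<lambda>y. F (x, y)) analytic_on {0}" if "x \<in> ball 0 r" for x
    unfolding analytic_at using r(1) r(2)[OF that] by (intro exI[of _ "ball 0 r"] conjI) simp_all
  moreover have "\<forall>\<^sub>F x in nhds 0. x \<in> ball (0::complex) r"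
    using r(1) by (intro eventually_nhds_in_open) simp_all
  ultimately show ?thesis by (auto elim: eventually_mono)
qed

lemma eventually_nhds_prod_slice:
  fixes P :: "complex \<times> complex \<Rightarrow> bool"
  assumes "\<forall>\<^sub>F p in nhds 0. P p"
  shows "\<forall>\<^sub>F x in nhds 0. \<forall>\<^sub>F y in nhds 0. P (x, y)"
proof -
  obtain A B where "eventually A (nhds 0)" "eventually B (nhds 0)" "\<And>x y. A x \<Longrightarrow> B y \<Longrightarrow> P (x, y)"
    using assms unfolding zero_prod_def nhds_prod eventually_prod_filter by metis
  then show ?thesis by (auto elim!: eventually_mono)
qed

lemma analytic_at_tendsto:
  assumes "f analytic_on {0}" shows "(f \<longlongrightarrow> f 0) (nhds 0)"
proof -
  have "isCont f 0"
    using assms analytic_at_imp_isCont by blast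
  then show ?thesis by (simp add: isCont_def tendsto_at_iff_tendsto_nhds)
qed

lemma eventually_nhds_curve:
  fixes P :: "complex \<times> complex \<Rightarrow> bool"
  assumes "\<forall>\<^sub>F p in nhds 0. P p" "A analytic_on {0}" "B analytic_on {0}" "A 0 = 0" "B 0 = 0"
  shows "\<forall>\<^sub>F t in nhds 0. P (A t, B t)"
proof -
  have "((\<lambda>t. (A t, B t)) \<longlongrightarrow> (A 0, B 0)) (nhds 0)"
    by (intro tendsto_Pair analytic_at_tendsto assms)
  then have "filterlim (\<lambda>t. (A t, B t)) (nhds 0) (nhds 0)"
    using assms(4,5) by (simp add: zero_prod_def)
  with assms(1) show ?thesis by (rule eventually_compose_filterlim)
qed

lemma eventually_nhds_germ2:
  fixes P :: "complex \<times> complex \<Rightarrow> bool"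
  assumes "\<forall>\<^sub>F p in nhds 0. P p" "holomorphic_germ2 g" "holomorphic_germ2 h" "g 0 = 0" "h 0 = 0"
  shows "\<forall>\<^sub>F p in nhds 0. P (g p, h p)"
proof -
  have "((\<lambda>p. (g p, h p)) \<longlongrightarrow> (g 0, h 0)) (nhds 0)"
    by (intro tendsto_Pair holomorphic_germ2_tendsto assms)
  then have "filterlim (\<lambda>p. (g p, h p)) (nhds 0) (nhds 0)"
    using assms(4,5) by (simp add: zero_prod_def)
  with assms(1) show ?thesis by (rule eventually_compose_filterlim)
qed

section \<open>The implicit function theorem for holomorphic germs\<close>

text \<open>
  The inverse function theorem for \<open>(x, y) \<mapsto> (x, F (x, y))\<close> yields a real-differentiable solution \<open>c\<close>.
  Differentiating \<open>F (x, c x) = 0\<close> shows that its derivative is multiplication by the complex number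
  \<open>- F\<^sub>x / F\<^sub>y\<close>, so \<open>c\<close> is holomorphic.
\<close>

lemma implicit_function_germ:
  assumes F: "holomorphic_germ2 F" and F0: "F 0 = 0" and nz: "deriv (\<lambda>y. F (0, y)) 0 \<noteq> 0"
  obtains c where "c analytic_on {0}" "c 0 = 0" "\<forall>\<^sub>F x in nhds 0. F (x, c x) = 0"
proof -
  define a where "a = (\<lambda>p. deriv_snd (\<lambda>p. F (snd p, fst p)) (snd p, fst p))"
  define b where "b = deriv_snd F"
  have germ_a: "holomorphic_germ2 a" unfolding a_def
    by (intro holomorphic_germ2_compose[OF holomorphic_germ2_deriv_snd] holomorphic_germ2_compose[OF F]
          holomorphic_germ2_fst holomorphic_germ2_snd) auto
  have germ_b: "holomorphic_germ2 b" unfolding b_def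
    by (rule holomorphic_germ2_deriv_snd[OF F])
  have "b 0 \<noteq> 0" using nz by (simp add: b_def deriv_snd_def)
  then have "\<forall>\<^sub>F p in nhds 0. b p \<noteq> 0"
    using holomorphic_germ2_tendsto[OF germ_b] by (rule tendsto_imp_eventually_ne[rotated])
  moreover have "\<forall>\<^sub>F p in nhds 0. (F has_derivative (\<lambda>z. a p * fst z + b p * snd z)) (at p)"
    using F unfolding holomorphic_germ2_iff
  proof eventually_elim
    case (elim p)
    then obtain a' b' where *: "(F has_derivative (\<lambda>z. a' * fst z + b' * snd z)) (at p)"
      by (rule complex_differentiable2E)
    then have "(F has_derivative (\<lambda>(h, k). a' * h + b' * k)) (at (fst p, snd p))"
      by (simp add: case_prod_unfold)
    from has_derivative_slices[OF this] have "a' = a p" "b' = b p"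
      by (simp_all add: a_def b_def deriv_snd_def DERIV_imp_deriv)
    with * show ?case by simp
  qed
  ultimately have "\<forall>\<^sub>F p in nhds 0. b p \<noteq> 0 \<and> isCont a p \<and> isCont b p \<and>
      (F has_derivative (\<lambda>z. a p * fst z + b p * snd z)) (at p)"
    using holomorphic_germ2_continuous[OF germ_a] holomorphic_germ2_continuous[OF germ_b]
    by eventually_elim simp
  then obtain U where U: "open U" "0 \<in> U" "\<forall>p\<in>U. b p \<noteq> 0 \<and> isCont a p \<and> isCont b p \<and>
      (F has_derivative (\<lambda>z. a p * fst z + b p * snd z)) (at p)"
    unfolding eventually_nhds by (elim exE conjE) (rule that)
  define E :: "complex \<Rightarrow>\<^sub>L (complex \<times> complex)" where "E = Blinfun (\<lambda>w. (0, w))"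
  define E1 :: "complex \<Rightarrow>\<^sub>L (complex \<times> complex)" where "E1 = Blinfun (\<lambda>w. (w, 0))"
  have E: "blinfun_apply E = (\<lambda>w. (0, w))" "blinfun_apply E1 = (\<lambda>w. (w, 0))"
    unfolding E_def E1_def
    by (rule bounded_linear_Blinfun_apply, intro bounded_linear_Pair bounded_linear_zero bounded_linear_ident)+
  define \<Phi> where "\<Phi> = (\<lambda>p. (fst p, F p))"
  \<comment> \<open>The derivative of \<open>\<Phi>\<close>, composed of bounded linear maps so that its continuity in \<open>p\<close> is visible.\<close>
  define \<Phi>' where "\<Phi>' = (\<lambda>p. (E1 o\<^sub>L fst_blinfun) + (E o\<^sub>L
      ((blinfun_mult_right (a p) o\<^sub>L fst_blinfun) + (blinfun_mult_right (b p) o\<^sub>L snd_blinfun))))"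
  have \<Phi>': "blinfun_apply (\<Phi>' p) = (\<lambda>z. (fst z, a p * fst z + b p * snd z))" for p
    by (auto simp: \<Phi>'_def blinfun.add_left E)
  define J where "J = (E1 o\<^sub>L fst_blinfun) + (E o\<^sub>L
      ((blinfun_mult_right (- a 0 / b 0) o\<^sub>L fst_blinfun) + (blinfun_mult_right (1 / b 0) o\<^sub>L snd_blinfun)))"
  have der: "(\<Phi> has_derivative blinfun_apply (\<Phi>' p)) (at p)" if "p \<in> U" for p
    unfolding \<Phi>' unfolding \<Phi>_def using U(3) that
    by (intro has_derivative_Pair has_derivative_fst has_derivative_ident) simp
  have cont: "continuous_on U \<Phi>'"
    unfolding \<Phi>'_def using U(3)
    by (intro continuous_intros bounded_linear.continuous_on[OF bounded_linear_blinfun_mult_right]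
           continuous_at_imp_continuous_on) simp_all
  have J: "J o\<^sub>L \<Phi>' 0 = id_blinfun"
    using \<open>b 0 \<noteq> 0\<close>
    by (intro blinfun_eqI) (simp add: \<Phi>' J_def blinfun.add_left E prod_eq_iff field_simps)
  obtain U' V g g' where g: "open U'" "U' \<subseteq> U" "0 \<in> U'" "open V" "\<Phi> 0 \<in> V" "homeomorphism U' V \<Phi> g"
    "\<And>y. y \<in> V \<Longrightarrow> (g has_derivative (g' y)) (at y)"
    by (rule inverse_function_theorem[OF U(1) der cont U(2) J]) (assumption, rule that)
  define c where "c = (\<lambda>x. snd (g (x, 0)))"
  have \<Phi>0: "\<Phi> 0 = 0" using F0 by (simp add: \<Phi>_def zero_prod_def)
  have gV: "g v \<in> U'" "\<Phi> (g v) = v" if "v \<in> V" for v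
    using g(6) that by (auto simp: homeomorphism_def)
  have g_c: "g (x, 0) = (x, c x)" "F (x, c x) = 0" "(x, c x) \<in> U" if "(x, 0) \<in> V" for x
  proof -
    show *: "g (x, 0) = (x, c x)"
      using gV(2)[OF that] by (simp add: \<Phi>_def c_def prod_eq_iff)
    show "F (x, c x) = 0"
      using gV(2)[OF that] by (simp add: \<Phi>_def * )
    show "(x, c x) \<in> U" using gV(1)[OF that] g(2) by (auto simp: * )
  qed
  have "filterlim (\<lambda>x::complex. (x, 0::complex)) (nhds 0) (nhds 0)"
    unfolding zero_prod_def by (intro tendsto_Pair tendsto_const filterlim_ident)
  then have V0: "\<forall>\<^sub>F x in nhds 0. (x, 0) \<in> V"
    using eventually_nhds_in_open[OF g(4,5)] unfolding \<Phi>0 by (rule eventually_compose_filterlim[rotated])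
  have c_diff: "c field_differentiable at x" if x: "\<forall>\<^sub>F x in nhds x. (x, 0) \<in> V" for x
  proof -
    have xV: "(x, 0) \<in> V" using x by (rule eventually_nhds_x_imp_x)
    define D where "D = (\<lambda>h. snd (g' (x, 0) (h, 0)))"
    have c: "(c has_derivative D) (at x)"
      unfolding c_def D_def
      by (intro has_derivative_snd has_derivative_compose[where f = "\<lambda>x. (x, 0)" and f' = "\<lambda>h. (h, 0)" and g = g, OF _ g(7)[OF xV]]
           has_derivative_Pair has_derivative_ident has_derivative_const)
    let ?a = "a (x, c x)" and ?b = "b (x, c x)"
    have "(F has_derivative (\<lambda>z. ?a * fst z + ?b * snd z)) (at (x, c x))" and b: "?b \<noteq> 0"
      using U(3) g_c(3)[OF xV] by auto
    from has_derivative_compose[where f = "\<lambda>x. (x, c x)" and g = F, OF has_derivative_Pair[OF has_derivative_ident c] this(1)]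
    have "((\<lambda>x. F (x, c x)) has_derivative (\<lambda>h. ?a * h + ?b * D h)) (at x)"
      by simp
    moreover have "((\<lambda>x. F (x, c x)) has_derivative (\<lambda>h. 0)) (at x)"
      using x by (intro has_derivative_transform_eventually[OF has_derivative_const, of 0])
         (auto simp: g_c eventually_at_filter xV elim!: eventually_mono)
    ultimately have eq: "(\<lambda>h. ?a * h + ?b * D h) = (\<lambda>h. 0)"
      by (rule has_derivative_unique)
    have "D = (*) (- ?a / ?b)"
    proof
      fix h show "D h = - ?a / ?b * h"
        using fun_cong[OF eq, of h] b by (simp add: field_simps add_eq_0_iff2)
    qed
    with c show ?thesis
      unfolding field_differentiable_def has_field_derivative_def by metis
  qed
  show thesis
  proof (rule that)
    show "c analytic_on {0}"
      unfolding analytic_at_iff_eventually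
      by (rule eventually_mono[OF V0[THEN iffD2[OF eventually_eventually]]]) (rule c_diff)
    have "g 0 = 0" using g(6) \<open>0 \<in> U'\<close> \<Phi>0 by (metis homeomorphism_apply1)
    then show "c 0 = 0" by (simp add: c_def zero_prod_def)
    show "\<forall>\<^sub>F x in nhds 0. F (x, c x) = 0"
      using V0 by eventually_elim (rule g_c)
  qed
qed

section \<open>Expansion in powers of the second variable\<close>

text \<open>
  By repeated use of \<open>holomorphic_germ2_divide_snd\<close>: the coefficients are the values of the successive
  quotients on the line \<open>y = 0\<close>.
\<close>

lemma holomorphic_germ2_expand_snd:
  assumes "holomorphic_germ2 F"
  shows "\<exists>a R. (\<forall>j<m. a j analytic_on {0}) \<and> holomorphic_germ2 R \<and>
    (\<forall>\<^sub>F p in nhds 0. F p = (\<Sum>j<m. a j (fst p) * snd p ^ j) + snd p ^ m * R p)"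
proof (induction m)
  case 0
  show ?case
  proof (intro exI conjI)
    show "\<forall>j<0. (\<lambda>_. 0) analytic_on {0}" by simp
    show "holomorphic_germ2 F" by (rule assms)
    show "\<forall>\<^sub>F p in nhds 0. F p = (\<Sum>j<0. (\<lambda>_. 0) (fst p) * snd p ^ j) + snd p ^ 0 * F p" by simp
  qed
next
  case (Suc m)
  then obtain a R where a: "\<forall>j<m. a j analytic_on {0}" and R: "holomorphic_germ2 R"
    and eq: "\<forall>\<^sub>F p in nhds 0. F p = (\<Sum>j<m. a j (fst p) * snd p ^ j) + snd p ^ m * R p"
    by (elim exE conjE) (rule that)
  obtain R' where R': "holomorphic_germ2 R'" "\<forall>\<^sub>F p in nhds 0. R p = R (fst p, 0) + snd p * R' p"
    by (rule holomorphic_germ2_divide_snd[OF R])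
  have eq': "\<forall>\<^sub>F p in nhds 0. F p = (\<Sum>j<Suc m. (a(m := \<lambda>x. R (x, 0))) j (fst p) * snd p ^ j) + snd p ^ Suc m * R' p"
    using eq R'(2) by eventually_elim (simp add: algebra_simps)
  have a': "\<forall>j<Suc m. (a(m := \<lambda>x. R (x, 0))) j analytic_on {0}"
    using a holomorphic_germ2_slice_fst[OF R] by (simp add: less_Suc_eq)
  show ?case by (intro exI conjI) (rule a' R'(1) eq')+
qed

text \<open>
  The coefficients of an expansion with holomorphic remainder are the Taylor coefficients; this is
  how the coefficients produced by repeated division are identified.
\<close>

lemma higher_deriv_of_expansion:
  assumes r: "r analytic_on {0}" and eq: "\<forall>\<^sub>F y in nhds 0. \<phi> y = (\<Sum>j<m. a j * y ^ j) + y ^ m * r y"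
  shows "k < m \<Longrightarrow> (deriv ^^ k) \<phi> 0 = fact k * a k" and "(deriv ^^ m) \<phi> 0 = fact m * r 0"
proof -
  define H where "H = (\<Sum>j<m. fps_const (a j) * fps_X ^ j) + fps_X ^ m * fps_expansion r 0"
  have "(\<lambda>y. (\<Sum>j<m. a j * y ^ j) + y ^ m * r y) has_fps_expansion H"
    unfolding H_def by (intro fps_expansion_intros analytic_at_imp_has_fps_expansion_0 r)
  then have "\<phi> has_fps_expansion H"
    using eq by (subst has_fps_expansion_cong[OF _ refl])
  then have *: "(deriv ^^ k) \<phi> 0 = fact k * fps_nth H k" for k
    by (simp add: fps_nth_fps_expansion)
  have nth: "fps_nth H k = (if k < m then a k else fps_nth (fps_expansion r 0) (k - m))" for k
    unfolding H_def
    by (simp add: fps_sum_nth fps_X_power_mult_nth fps_X_power_nth if_distrib[of "\<lambda>x. _ * x"] cong: if_cong)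
  show "(deriv ^^ k) \<phi> 0 = fact k * a k" if "k < m"
    using that by (simp add: * nth)
  show "(deriv ^^ m) \<phi> 0 = fact m * r 0"
    by (simp add: * nth fps_expansion_def)
qed

lemma funpow_deriv_snd: "(deriv_snd ^^ k) F (x, y) = (deriv ^^ k) (\<lambda>y. F (x, y)) y"
proof (induction k arbitrary: y)
  case (Suc k)
  have "(\<lambda>y. (deriv_snd ^^ k) F (x, y)) = (deriv ^^ k) (\<lambda>y. F (x, y))"
    using Suc.IH by auto
  then show ?case by (simp add: deriv_snd_def[of "(deriv_snd ^^ k) F"])
qed simp

lemma holomorphic_germ2_funpow_deriv_snd:
  "holomorphic_germ2 F \<Longrightarrow> holomorphic_germ2 ((deriv_snd ^^ k) F)"
  by (induction k) (simp_all add: holomorphic_germ2_deriv_snd)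

lemma analytic_factor_order:
  assumes a: "a analytic_on {0}" and nz: "\<not> (\<forall>\<^sub>F x in nhds 0. a x = 0)"
  shows "\<exists>k b. b analytic_on {0} \<and> b 0 \<noteq> 0 \<and> (\<forall>\<^sub>F x in nhds 0. a x = x ^ k * (b x :: complex))"
proof -
  define A where "A = fps_expansion a 0"
  have A: "a has_fps_expansion A"
    unfolding A_def by (rule analytic_at_imp_has_fps_expansion_0[OF a])
  have "A \<noteq> 0"
  proof
    assume "A = 0"
    with A have "\<forall>\<^sub>F x in nhds 0. a x = 0"
      by (auto simp: has_fps_expansion_def elim: eventually_mono)
    with nz show False ..
  qed
  define k where "k = subdegree A"
  define b where "b = (\<lambda>x. if x = 0 then fps_nth A k else a x / x ^ k)"
  have "b has_fps_expansion fps_shift k A"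
    unfolding b_def using A by (intro has_fps_expansion_shift) (simp_all add: k_def)
  then have "b analytic_on {0}" by (rule has_fps_expansion_imp_analytic_0)
  moreover have "b 0 \<noteq> 0"
    using \<open>A \<noteq> 0\<close> by (simp add: b_def k_def)
  moreover have "a 0 = 0 ^ k * b 0"
    using has_fps_expansion_imp_0_eq_fps_nth_0[OF A] \<open>A \<noteq> 0\<close> by (cases "k = 0") (auto simp: b_def k_def power_0_left intro!: nth_less_subdegree_zero)
  then have "a x = x ^ k * b x" for x
    by (cases "x = 0") (auto simp: b_def)
  then have "\<forall>\<^sub>F x in nhds 0. a x = x ^ k * b x" by (rule always_eventually[OF allI])
  ultimately show ?thesis by (intro exI conjI)
qed

section \<open>Newton's induction\<close>

text \<open>
  If a root \<open>z\<close> had multiplicity \<open>m\<close>, then \<open>p\<close> would be a multiple of \<open>(X - z) ^ m\<close>, whose coefficient of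
  degree \<open>m - 1\<close> is \<open>- m * z\<close>. Hence \<open>z = 0\<close> and \<open>p\<close> is a monomial, which the coefficient \<open>j\<close> excludes.
\<close>

lemma poly_root_multiplicity_less:
  fixes p :: "complex poly"
  assumes deg: "degree p = m" "m > 0" and c0: "coeff p (m - 1) = 0" and j: "j < m" "coeff p j \<noteq> 0"
  obtains z k where "0 < k" "k < m" "\<And>i. i < k \<Longrightarrow> coeff (pcompose p [:z, 1:]) i = 0"
    "coeff (pcompose p [:z, 1:]) k \<noteq> 0"
proof -
  have "coeff p m \<noteq> 0" using deg by auto
  with deg(2) have "coeff p 0 = 0 \<or> (\<exists>i\<in>{1..m}. coeff p i \<noteq> 0)" by force
  then obtain z where "(\<Sum>i\<le>m. coeff p i * z ^ i) = 0"
    by (rule fundamental_theorem_of_algebra)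
  then have z: "poly p z = 0" by (simp add: poly_altdef deg)
  define q where "q = pcompose p [:z, 1:]"
  have degq: "degree q = m" using deg by (simp add: q_def degree_pcompose)
  then have "q \<noteq> 0" using deg by auto
  define k where "k = (LEAST k. coeff q k \<noteq> 0)"
  have k: "coeff q k \<noteq> 0"
    unfolding k_def by (rule LeastI[of "\<lambda>k. coeff q k \<noteq> 0" "degree q"]) (use \<open>q \<noteq> 0\<close> in simp)
  have less: "coeff q i = 0" if "i < k" for i
    using not_less_Least[of i "\<lambda>k. coeff q k \<noteq> 0"] that by (simp add: k_def)
  have "coeff q 0 = 0"
    using z poly_0_coeff_0[of q] by (simp add: q_def poly_pcompose) 
  with k have "k > 0" by (cases k) auto
  have "k \<le> m" using k degq le_degree by metis
  moreover have "k \<noteq> m"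
  proof
    assume "k = m"
    have q: "q = monom (coeff q m) m"
    proof (rule poly_eqI)
      show "coeff q i = coeff (monom (coeff q m) m) i" for i
        using less[of i] degq \<open>k = m\<close> coeff_eq_0[of q i] by (cases i m rule: linorder_cases) auto
    qed
    have pq: "p = pcompose q [:- z, 1:]"
      by (simp add: q_def pcompose_assoc[symmetric] pcompose_pCons)
    have "pcompose ([:0, 1:] ^ m) [:- z, 1:] = [:- z, 1:] ^ m"
      by (induction m) (simp_all add: pcompose_1 pcompose_mult pcompose_pCons del: pcompose_idR)
    then have "pcompose q [:- z, 1:] = smult (coeff q m) ([:- z, 1:] ^ m)"
      by (subst q) (simp add: monom_altdef pcompose_smult pcompose_pCons)
    with pq have p: "p = smult (coeff q m) ([:- z, 1:] ^ m)" by simp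
    have choose: "m choose (m - 1) = m" using deg(2) by (cases m) auto
    have "coeff p (m - 1) = coeff q m * (of_nat m * (- z))"
      using deg(2) choose by (subst p) (simp add: coeff_linear_poly_power)
    with c0 k \<open>k = m\<close> deg(2) have "z = 0" by simp
    then have "p = q" by (simp add: q_def)
    with j q show False by (metis coeff_monom less_irrefl)
  qed
  ultimately have "k < m" by simp
  with \<open>k > 0\<close> less k show thesis unfolding q_def by (intro that)
qed


text \<open>
  A solution \<open>y = \<psi> (x ^ (1 / n))\<close> of \<open>f (x, y) = 0\<close>, that is, a possibly non-injective parametrization.
\<close>

definition puiseux_root :: "(complex \<times> complex \<Rightarrow> complex) \<Rightarrow> nat \<Rightarrow> (complex \<Rightarrow> complex) \<Rightarrow> bool" where
  "puiseux_root f n \<psi> \<longleftrightarrow> n > 0 \<and> \<psi> analytic_on {0} \<and> \<psi> 0 = 0 \<and> (\<forall>\<^sub>F t in nhds 0. f (t ^ n, \<psi> t) = 0)"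

text \<open>
  The points \<open>(j, k j)\<close>, where \<open>a j\<close> is not identically zero near \<open>0\<close> and \<open>k j\<close> is its order there, span
  the Newton polygon together with \<open>(m, 0)\<close>. The edge that ends at \<open>(m, 0)\<close> has slope \<open>- q / p\<close>, where \<open>q / p\<close> is the minimum of \<open>k j / (m - j)\<close>. Substituting
  \<open>x = u ^ p\<close> and \<open>y = u ^ q * z\<close>, each term \<open>a j x * y ^ j\<close> acquires the factor \<open>u ^ (q * m)\<close>, and exactly
  the points on the edge leave a nonzero \<open>d j 0\<close>.
\<close>

lemma newton_slope:
  fixes a :: "nat \<Rightarrow> complex \<Rightarrow> complex"
  assumes a: "\<And>j. j < m \<Longrightarrow> a j analytic_on {0}" and a0: "\<And>j. j < m \<Longrightarrow> a j 0 = 0"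
    and nz: "\<exists>j<m. \<not> (\<forall>\<^sub>F x in nhds 0. a j x = 0)"
  obtains p q d i where "p > 0" "q > 0" "\<And>j. j < m \<Longrightarrow> d j analytic_on {0}"
    "\<And>j. j < m \<Longrightarrow> \<forall>\<^sub>F u in nhds 0. a j (u ^ p) * u ^ (q * j) = u ^ (q * m) * d j u"
    "i < m" "d i 0 \<noteq> 0" "\<And>j. j < m \<Longrightarrow> \<forall>\<^sub>F x in nhds 0. a j x = 0 \<Longrightarrow> d j 0 = 0"
proof -
  define S where "S = {j. j < m \<and> \<not> (\<forall>\<^sub>F x in nhds 0. a j x = 0)}"
  have "\<forall>j\<in>S. \<exists>k b. b analytic_on {0} \<and> b 0 \<noteq> 0 \<and> (\<forall>\<^sub>F x in nhds 0. a j x = x ^ k * b x)"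
    using a unfolding S_def by (auto intro!: analytic_factor_order)
  then obtain k b where "\<forall>j\<in>S. b j analytic_on {0} \<and> b j 0 \<noteq> 0 \<and> (\<forall>\<^sub>F x in nhds 0. a j x = x ^ k j * b j x)"
    unfolding bchoice_iff by (elim exE) (rule that)
  then have b: "b j analytic_on {0}" "b j 0 \<noteq> 0" "\<forall>\<^sub>F x in nhds 0. a j x = x ^ k j * b j x" if "j \<in> S" for j
    using that by simp_all
  have k_pos: "k j > 0" if "j \<in> S" for j
    using eventually_nhds_x_imp_x[OF b(3)[OF that]] b(2)[OF that] a0[of j] that
    by (cases "k j") (auto simp: S_def)
  have "finite S" "S \<noteq> {}" using nz by (auto simp: S_def)
  then obtain i where i: "i \<in> S" "\<And>j. j \<in> S \<Longrightarrow> real (k i) / real (m - i) \<le> real (k j) / real (m - j)"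
    using ex_min_if_finite[of "(\<lambda>j. real (k j) / real (m - j)) ` S"] by (force simp: not_less)
  define p where "p = m - i"
  define q where "q = k i"
  have im: "i < m" using i(1) by (simp add: S_def)
  have slope: "q * (m - j) \<le> p * k j" if "j \<in> S" for j
  proof -
    have "real (q * (m - j)) \<le> real (p * k j)"
      using i(2)[OF that] im that by (simp add: p_def q_def S_def field_simps)
    then show ?thesis by linarith
  qed
  define d where "d = (\<lambda>j u. if j \<in> S then u ^ (p * k j - q * (m - j)) * b j (u ^ p) else 0)"
  have "((\<lambda>u::complex. u ^ p) \<longlongrightarrow> 0 ^ p) (nhds 0)"
    by (rule analytic_at_tendsto) (intro analytic_intros)
  then have pow: "filterlim (\<lambda>u::complex. u ^ p) (nhds 0) (nhds 0)"
    using im by (simp add: p_def power_0_left)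
  show thesis
  proof (rule that)
    show "p > 0" "q > 0" "i < m" using im i(1) k_pos by (auto simp: p_def q_def)
    show "d i 0 \<noteq> 0"
      using i(1) b(2)[OF i(1)] im by (simp add: power_0_left d_def p_def q_def)
    show "d j analytic_on {0}" if "j < m" for j
    proof (cases "j \<in> S")
      case True
      have "(b j \<circ> (\<lambda>u. u ^ p)) analytic_on {0}"
        using b(1)[OF True] im
        by (intro analytic_on_compose) (auto simp: p_def power_0_left intro!: analytic_intros)
      then show ?thesis
        using True by (auto simp: d_def o_def intro!: analytic_intros)
    qed (simp add: d_def)
    show "\<forall>\<^sub>F u in nhds 0. a j (u ^ p) * u ^ (q * j) = u ^ (q * m) * d j u" if j: "j < m" for j
    proof (cases "j \<in> S")
      case True
      have "p * k j + q * j = q * m + (p * k j - q * (m - j))"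
        using slope[OF True] j by (simp add: diff_mult_distrib2)
      then have *: "u ^ (p * k j) * u ^ (q * j) = u ^ (q * m) * u ^ (p * k j - q * (m - j))" for u :: complex
        by (simp flip: power_add)
      show ?thesis
        using eventually_compose_filterlim[OF b(3)[OF True] pow]
        by eventually_elim (use True * in \<open>simp add: d_def power_mult mult_ac\<close>)
    next
      case False
      with j have "\<forall>\<^sub>F x in nhds 0. a j x = 0" by (simp add: S_def)
      from eventually_compose_filterlim[OF this pow] show ?thesis
        by eventually_elim (use False in \<open>simp add: d_def\<close>)
    qed
    show "d j 0 = 0" if "j < m" "\<forall>\<^sub>F x in nhds 0. a j x = 0" for j
      using that by (simp add: d_def S_def)
  qed
qed


lemma higher_deriv_poly_0: "(deriv ^^ k) (poly Q) 0 = fact k * coeff Q (k :: nat)" for Q :: "complex poly"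
proof (rule higher_deriv_of_expansion(1))
  have "poly Q y = (\<Sum>j<Suc (k + degree Q). coeff Q j * y ^ j)" for y
    unfolding poly_altdef
    by (rule sum.mono_neutral_left) (auto simp: coeff_eq_0)
  then show "\<forall>\<^sub>F y in nhds 0. poly Q y =
      (\<Sum>j<Suc (k + degree Q). coeff Q j * y ^ j) + y ^ Suc (k + degree Q) * (\<lambda>_. 0) y"
    by simp
qed simp_all

text \<open>
  The induction described at the beginning; \<open>m\<close> is the order of \<open>f (0, y)\<close> at \<open>y = 0\<close>, expressed
  by derivatives because these are what the expansion lemmas compute.
\<close>

lemma newton_puiseux:
  assumes "holomorphic_germ2 f" "m > 0"
    and "\<And>k. k < m \<Longrightarrow> (deriv ^^ k) (\<lambda>y. f (0, y)) 0 = 0"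
    and "(deriv ^^ m) (\<lambda>y. f (0, y)) 0 \<noteq> 0"
  shows "\<exists>n \<psi>. puiseux_root f n \<psi>"
  using assms
proof (induction m arbitrary: f rule: less_induct)
  case (less m f)
  note f = less.prems(1) and m = less.prems(2)
  \<comment> \<open>The Tschirnhaus shift below moves the zero set \<open>y = c x\<close> of \<open>D\<close> to \<open>y = 0\<close>.\<close>
  define D where "D = (deriv_snd ^^ (m - 1)) f"
  have germ_D: "holomorphic_germ2 D"
    unfolding D_def by (rule holomorphic_germ2_funpow_deriv_snd[OF f])
  have D0: "D 0 = 0"
    using less.prems(3)[of "m - 1"] m by (simp add: D_def zero_prod_def funpow_deriv_snd)
  have "deriv (\<lambda>y. D (0, y)) 0 = (deriv ^^ Suc (m - 1)) (\<lambda>y. f (0, y)) 0"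
    by (simp add: D_def funpow_deriv_snd)
  with less.prems(4) m have D1: "deriv (\<lambda>y. D (0, y)) 0 \<noteq> 0" by simp
  obtain c where c: "c analytic_on {0}" "c 0 = 0" and Dc: "\<forall>\<^sub>F x in nhds 0. D (x, c x) = 0"
    by (rule implicit_function_germ[OF germ_D D0 D1])
  define F where "F = (\<lambda>p. f (fst p, c (fst p) + snd p))"
  have germ_F: "holomorphic_germ2 F"
    unfolding F_def
    by (intro holomorphic_germ2_compose[OF f] holomorphic_germ2_add holomorphic_germ2_analytic_fst[OF c(1)]
         holomorphic_germ2_fst holomorphic_germ2_snd) (simp_all add: c(2))
  obtain a R where a: "\<forall>j<m. a j analytic_on {0}" and R: "holomorphic_germ2 R"
    and F_eq: "\<forall>\<^sub>F p in nhds 0. F p = (\<Sum>j<m. a j (fst p) * snd p ^ j) + snd p ^ m * R p"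
    using holomorphic_germ2_expand_snd[OF germ_F, of m] by (elim exE conjE) (rule that)
  have coeffs: "\<forall>\<^sub>F x in nhds 0. (\<forall>k<m. (deriv ^^ k) (\<lambda>y. F (x, y)) 0 = fact k * a k x) \<and>
                  (deriv ^^ m) (\<lambda>y. F (x, y)) 0 = fact m * R (x, 0)"
    using eventually_nhds_prod_slice[OF F_eq] holomorphic_germ2_slice_snd[OF R]
  proof eventually_elim
    case (elim x)
    from higher_deriv_of_expansion[OF elim(2) elim(1)[unfolded fst_conv snd_conv]] show ?case by blast
  qed
  have F0: "(\<lambda>y. F (0, y)) = (\<lambda>y. f (0, y))" by (simp add: F_def c)
  have a0: "a j 0 = 0" if "j < m" for j
    using eventually_nhds_x_imp_x[OF coeffs] less.prems(3)[OF that] that by (simp add: F0)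
  have R0: "R 0 \<noteq> 0"
    using eventually_nhds_x_imp_x[OF coeffs] less.prems(4) by (auto simp: F0 zero_prod_def)
  \<comment> \<open>Up to a factorial, \<open>a (m - 1) x\<close> is the derivative \<open>D\<close> at \<open>(x, c x)\<close>, which is zero by the choice of \<open>c\<close>.\<close>
  have am: "\<forall>\<^sub>F x in nhds 0. a (m - 1) x = 0"
    using coeffs Dc
  proof eventually_elim
    case (elim x)
    have "(deriv ^^ (m - 1)) (\<lambda>y. F (x, y)) 0 = D (x, c x)"
      unfolding D_def funpow_deriv_snd higher_deriv_shift_0[of _ _ "c x"] by (simp add: F_def o_def)
    with elim m show ?case by simp
  qed
  show ?case
  proof (cases "\<exists>j<m. \<not> (\<forall>\<^sub>F x in nhds 0. a j x = 0)")
    case False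
    with m have "\<forall>\<^sub>F x in nhds 0. a 0 x = 0" by simp
    moreover have "\<forall>\<^sub>F x in nhds 0. F (x, 0) = (\<Sum>j<m. a j x * 0 ^ j) + 0 ^ m * R (x, 0)"
      using eventually_nhds_curve[OF F_eq, of "\<lambda>x. x" "\<lambda>_. 0"] by (simp add: analytic_on_ident)
    ultimately have "\<forall>\<^sub>F x in nhds 0. f (x, c x) = 0"
      by eventually_elim (use m in \<open>simp add: F_def power_0_left if_distrib[of "\<lambda>x. _ * x"] cong: if_cong\<close>)
    then have "puiseux_root f 1 c" using c by (simp add: puiseux_root_def)
    then show ?thesis by (intro exI)
  next
    case True
    obtain p q d i where pq: "p > 0" "q > 0" and d: "\<And>j. j < m \<Longrightarrow> d j analytic_on {0}"
      and d_eq: "\<And>j. j < m \<Longrightarrow> \<forall>\<^sub>F u in nhds 0. a j (u ^ p) * u ^ (q * j) = u ^ (q * m) * d j u"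
      and i: "i < m" "d i 0 \<noteq> 0"
      and d0: "\<And>j. j < m \<Longrightarrow> \<forall>\<^sub>F x in nhds 0. a j x = 0 \<Longrightarrow> d j 0 = 0"
      by (rule newton_slope[OF a[rule_format] a0 True]) (assumption, assumption, rule that)
    \<comment> \<open>\<open>P\<close> is the characteristic polynomial of the edge: the value at \<open>u = 0\<close> after cancelling \<open>u ^ (q * m)\<close>.\<close>
    define P where "P = (\<Sum>j<m. monom (d j 0) j) + monom (R 0) m"
    have coeff_P: "coeff P j = (if j < m then d j 0 else if j = m then R 0 else 0)" for j
      by (simp add: P_def coeff_sum)
    have deg: "degree P = m"
      using R0 by (intro antisym degree_le le_degree) (auto simp: coeff_P)
    obtain z k where k: "0 < k" "k < m" and
      z: "\<And>i. i < k \<Longrightarrow> coeff (pcompose P [:z, 1:]) i = 0" "coeff (pcompose P [:z, 1:]) k \<noteq> 0"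
    proof (rule poly_root_multiplicity_less[OF deg m _ i(1)])
      show "coeff P (m - 1) = 0" using d0[OF _ am] m by (simp add: coeff_P)
      show "coeff P i \<noteq> 0" using i by (simp add: coeff_P)
    qed (rule that)
    \<comment> \<open>The substitution \<open>x = u ^ p\<close>, \<open>y = u ^ q * z'\<close>, with \<open>z' = z + v\<close> centred at the root \<open>z\<close> and \<open>w = (u, v)\<close>.
      As \<open>q > 0\<close>, it maps \<open>w = 0\<close> to the origin for any \<open>z\<close>, so germs at the origin can be pulled back along it.\<close>
    define g where "g = (\<lambda>w :: complex \<times> complex. fst w ^ p)"
    define h where "h = (\<lambda>w :: complex \<times> complex. fst w ^ q * (z + snd w))"
    have gh: "holomorphic_germ2 g" "holomorphic_germ2 h" "g 0 = 0" "h 0 = 0"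
      unfolding g_def h_def using pq
      by (auto simp: power_0_left intro!: holomorphic_germ2_power holomorphic_germ2_mult holomorphic_germ2_add
            holomorphic_germ2_const holomorphic_germ2_fst holomorphic_germ2_snd)
    define H where "H = (\<lambda>w. (\<Sum>j<m. d j (fst w) * (z + snd w) ^ j) + (z + snd w) ^ m * R (g w, h w))"
    have germ_H: "holomorphic_germ2 H"
      unfolding H_def
      by (intro holomorphic_germ2_add holomorphic_germ2_sum holomorphic_germ2_mult holomorphic_germ2_power
            holomorphic_germ2_const holomorphic_germ2_snd holomorphic_germ2_analytic_fst d
            holomorphic_germ2_compose[OF R] gh) simp
    have "(\<lambda>w. H (0, w)) = poly (pcompose P [:z, 1:])"
      using pq by (auto simp: H_def P_def g_def h_def power_0_left poly_pcompose poly_sum poly_monom zero_prod_def)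
    then have "\<And>j. (deriv ^^ j) (\<lambda>w. H (0, w)) 0 = fact j * coeff (pcompose P [:z, 1:]) j"
      by (simp only: higher_deriv_poly_0)
    then obtain n \<psi> where n\<psi>: "puiseux_root H n \<psi>"
      using less.IH[OF k(2) germ_H k(1)] z by auto
    have "filterlim fst (nhds (0::complex)) (nhds (0 :: complex \<times> complex))"
      using holomorphic_germ2_tendsto[OF holomorphic_germ2_fst] by simp
    then have "\<forall>\<^sub>F w in nhds (0 :: complex \<times> complex). \<forall>j\<in>{..<m}.
        a j (fst w ^ p) * fst w ^ (q * j) = fst w ^ (q * m) * d j (fst w)"
      by (intro eventually_ball_finite ballI eventually_compose_filterlim[OF d_eq]) simp_all
    then have "\<forall>\<^sub>F w in nhds 0. F (g w, h w) = fst w ^ (q * m) * H w"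
      using eventually_nhds_germ2[OF F_eq gh]
    proof eventually_elim
      case (elim w)
      have "a j (g w) * h w ^ j = fst w ^ (q * m) * (d j (fst w) * (z + snd w) ^ j)" if "j < m" for j
        using elim(1) that by (simp add: g_def h_def power_mult_distrib flip: power_mult mult.assoc)
      moreover have "h w ^ m = fst w ^ (q * m) * (z + snd w) ^ m"
        by (simp add: h_def power_mult_distrib flip: power_mult)
      ultimately show ?case
        using elim(2) by (simp add: H_def distrib_left sum_distrib_left)
    qed
    moreover have tn: "(\<lambda>t::complex. t ^ n) analytic_on {0}"
      by (intro analytic_intros)
    ultimately have "\<forall>\<^sub>F t in nhds 0. F (g (t ^ n, \<psi> t), h (t ^ n, \<psi> t)) = (t ^ n) ^ (q * m) * H (t ^ n, \<psi> t)"
      using n\<psi> tn eventually_nhds_curve[of "\<lambda>w. F (g w, h w) = fst w ^ (q * m) * H w" "\<lambda>t. t ^ n" \<psi>]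
      by (auto simp: puiseux_root_def power_0_left)
    moreover have "\<forall>\<^sub>F t in nhds 0. H (t ^ n, \<psi> t) = 0"
      using n\<psi> by (simp add: puiseux_root_def)
    ultimately have "\<forall>\<^sub>F t in nhds 0. f (t ^ (n * p), c (t ^ (n * p)) + t ^ (n * q) * (z + \<psi> t)) = 0"
      by eventually_elim (simp add: F_def g_def h_def power_mult)
    moreover have "(\<lambda>t. c (t ^ (n * p)) + t ^ (n * q) * (z + \<psi> t)) analytic_on {0}"
    proof -
      have "(c \<circ> (\<lambda>t. t ^ (n * p))) analytic_on {0}"
        using c(1) pq n\<psi>
        by (intro analytic_on_compose) (auto simp: puiseux_root_def power_0_left intro!: analytic_intros)
      then show ?thesis
        using n\<psi> by (auto simp: o_def puiseux_root_def intro!: analytic_intros)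
    qed
    ultimately have "puiseux_root f (n * p) (\<lambda>t. c (t ^ (n * p)) + t ^ (n * q) * (z + \<psi> t))"
      using n\<psi> pq c(2) by (simp add: puiseux_root_def power_0_left)
    then show ?thesis by (intro exI)
  qed
qed

section \<open>Minimal parametrizations are injective\<close>

lemma complex_nth_root_exists:
  assumes "d > 0"
  shows "\<exists>t. t ^ d = (w :: complex)"
proof (cases "w = 0")
  case True
  with assms show ?thesis by (intro exI[of _ 0]) (simp add: power_0_left)
next
  case False
  have "exp (Ln w / of_nat d) ^ d = w"
    using False assms by (simp flip: exp_of_nat_mult)
  then show ?thesis by (rule exI)
qed

text \<open>
  Comparing Taylor coefficients in \<open>\<phi> (\<zeta> * s) = \<phi> s\<close> gives \<open>\<zeta> ^ k * c k = c k\<close>, so only exponents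
  divisible by the order \<open>d\<close> of \<open>\<zeta>\<close> occur and \<open>\<phi> t = \<xi> (t ^ d)\<close>. As \<open>d\<close> divides \<open>n\<close>, also \<open>t ^ n\<close> is a
  function of \<open>t ^ d\<close>.
\<close>

lemma puiseux_root_reduce:
  assumes root: "puiseux_root f n \<phi>" and \<zeta>: "\<zeta> ^ n = 1" "\<zeta> \<noteq> 1"
    and inv: "\<forall>\<^sub>F s in nhds 0. \<phi> (\<zeta> * s) = \<phi> s"
  shows "\<exists>n'<n. \<exists>\<xi>. puiseux_root f n' \<xi>"
proof -
  have n: "n > 0" and \<phi>: "\<phi> analytic_on {0}" "\<phi> 0 = 0" and f0: "\<forall>\<^sub>F t in nhds 0. f (t ^ n, \<phi> t) = 0"
    using root by (simp_all add: puiseux_root_def)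
  define d where "d = (LEAST d. d > 0 \<and> \<zeta> ^ d = 1)"
  have d: "d > 0" "\<zeta> ^ d = 1"
    using LeastI[of "\<lambda>d. d > 0 \<and> \<zeta> ^ d = 1" n] n \<zeta>(1) by (simp_all add: d_def)
  have dvd: "d dvd k" if "\<zeta> ^ k = 1" for k
  proof -
    have "\<zeta> ^ k = \<zeta> ^ (d * (k div d) + k mod d)" by simp
    also have "\<dots> = (\<zeta> ^ d) ^ (k div d) * \<zeta> ^ (k mod d)" by (simp only: power_add power_mult)
    finally have "\<zeta> ^ (k mod d) = 1" using that d by simp
    moreover have "k mod d < d" using d by simp
    ultimately have "k mod d = 0"
      using not_less_Least[of "k mod d" "\<lambda>d. d > 0 \<and> \<zeta> ^ d = 1"] by (simp add: d_def)
    then show ?thesis by (rule mod_0_imp_dvd)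
  qed
  have norm_\<zeta>: "norm \<zeta> = 1"
    using \<zeta>(1) n by (metis norm_one norm_power power_eq_1_iff norm_ge_zero gr_implies_not0 abs_of_nonneg)
  have "d \<noteq> 1" using d \<zeta>(2) by auto
  obtain e where e: "n = d * e" using dvd[OF \<zeta>(1)] by (rule dvdE)
  have e_less: "e > 0" "e < n" using e n d \<open>d \<noteq> 1\<close> by auto
  obtain S where S: "open S" "0 \<in> S" "\<phi> holomorphic_on S"
    using \<phi>(1) unfolding analytic_at by (elim exE conjE) (rule that)
  obtain T where T: "open T" "0 \<in> T" "\<And>t. t \<in> T \<Longrightarrow> f (t ^ n, \<phi> t) = 0"
    using f0 unfolding eventually_nhds by metis
  obtain r where r: "r > 0" "ball 0 r \<subseteq> S \<inter> T"
    using S(1,2) T(1,2) by (metis IntI open_Int open_contains_ball)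
  have holo: "\<phi> holomorphic_on ball 0 r" using S(3) r(2) by (blast intro: holomorphic_on_subset)
  define c where "c = (\<lambda>k. (deriv ^^ k) \<phi> 0 / fact k)"
  have sums: "(\<lambda>k. c k * t ^ k) sums \<phi> t" if "t \<in> ball 0 r" for t
    using holomorphic_power_series[OF holo that] by (simp add: c_def)
  have c0: "c k = 0" if "\<not> d dvd k" for k
  proof -
    have "(deriv ^^ k) (\<lambda>s. \<phi> (\<zeta> * s)) 0 = \<zeta> ^ k * (deriv ^^ k) \<phi> (\<zeta> * 0)"
      by (rule higher_deriv_compose_linear[OF holo open_ball[of 0 r] open_ball])
         (use r(1) in \<open>simp_all add: norm_mult norm_\<zeta>\<close>)
    moreover have "(deriv ^^ k) (\<lambda>s. \<phi> (\<zeta> * s)) 0 = (deriv ^^ k) \<phi> 0"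
      by (rule higher_deriv_cong_ev[OF inv refl])
    ultimately have "\<zeta> ^ k * c k = c k" by (simp add: c_def)
    moreover have "\<zeta> ^ k \<noteq> 1" using dvd that by blast
    ultimately show ?thesis by simp
  qed
  define \<xi> where "\<xi> = (\<lambda>w. \<Sum>k. c (d * k) * w ^ k)"
  have \<xi>_sums: "(\<lambda>k. c (d * k) * (t ^ d) ^ k) sums \<phi> t" if "t \<in> ball 0 r" for t
  proof -
    have "strict_mono (\<lambda>k. d * k)" using d by (simp add: strict_mono_def)
    moreover have "c k * t ^ k = 0" if "k \<notin> range (\<lambda>k. d * k)" for k
      using c0[of k] that by (auto simp: dvd_def)
    ultimately have "(\<lambda>k. c (d * k) * t ^ (d * k)) sums \<phi> t"
      using sums[OF that] by (subst sums_mono_reindex[of "\<lambda>k. d * k" "\<lambda>k. c k * t ^ k"])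
    then show ?thesis by (simp add: power_mult)
  qed
  have \<xi>: "\<xi> (t ^ d) = \<phi> t" if "t \<in> ball 0 r" for t
    using sums_unique[OF \<xi>_sums[OF that]] by (simp add: \<xi>_def)
  \<comment> \<open>As \<open>t ^ d\<close> maps the disc onto the disc of radius \<open>r ^ d\<close>, convergence of \<open>\<xi>\<close> follows from that of \<open>\<phi>\<close>.\<close>
  have root: "\<exists>t\<in>ball 0 r. t ^ d = w" if "w \<in> ball 0 (r ^ d)" for w :: complex
  proof -
    obtain t where t: "t ^ d = w" using complex_nth_root_exists[OF d(1)] by metis
    then have "norm t ^ d < r ^ d" using that by (simp flip: norm_power)
    then have "norm t < r" using r(1) by (intro power_less_imp_less_base[of "norm t" d r]) simp_all
    with t show ?thesis by auto
  qed
  have "\<xi> holomorphic_on ball 0 (r ^ d)"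
  proof (rule power_series_holomorphic)
    fix w :: complex assume "w \<in> ball 0 (r ^ d)"
    then obtain t where "t \<in> ball 0 r" "t ^ d = w" using root by metis
    with \<xi>_sums[of t] \<xi>[of t] show "(\<lambda>k. c (d * k) * (w - 0) ^ k) sums \<xi> w" by simp
  qed
  then have "\<xi> analytic_on {0}"
    unfolding analytic_at using r(1) by (intro exI[of _ "ball 0 (r ^ d)"] conjI) simp_all
  moreover have "\<xi> 0 = 0" using \<xi>[of 0] r(1) d(1) \<phi>(2) by (simp add: power_0_left)
  moreover have "f (w ^ e, \<xi> w) = 0" if w: "w \<in> ball 0 (r ^ d)" for w
  proof -
    obtain t where t: "t \<in> ball 0 r" "t ^ d = w" using root[OF w] by metis
    have "t \<in> T" using t(1) r(2) by (meson IntD2 subsetD)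
    then show ?thesis using T(3)[of t] \<xi>[OF t(1)] by (simp add: e power_mult t(2))
  qed
  then have "\<forall>\<^sub>F w in nhds 0. f (w ^ e, \<xi> w) = 0"
    using eventually_nhds_in_open[of "ball (0::complex) (r ^ d)" 0] r(1) by (auto elim: eventually_mono)
  ultimately have "puiseux_root f e \<xi>" using e_less by (simp add: puiseux_root_def)
  with e_less(2) show ?thesis by (intro exI conjI)
qed

text \<open>
  If \<open>t ^ n = s ^ n\<close> with \<open>s \<noteq> 0\<close>, then \<open>t = \<zeta> * s\<close> for an \<open>n\<close>-th root of unity \<open>\<zeta>\<close>. For each of the finitely
  many \<open>\<zeta> \<noteq> 1\<close>, minimality and \<open>puiseux_root_reduce\<close> exclude that \<open>\<phi> (\<zeta> * s) - \<phi> s\<close> vanishes identically,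
  so it has no zeros near \<open>0\<close> except possibly \<open>0\<close> itself.
\<close>

lemma minimal_puiseux_root_inj:
  assumes root: "puiseux_root f n \<phi>" and min: "\<And>n' \<xi>. n' < n \<Longrightarrow> \<not> puiseux_root f n' \<xi>"
  obtains V where "open V" "0 \<in> V" "\<phi> holomorphic_on V" "inj_on (\<lambda>t. (t ^ n, \<phi> t)) V"
    "\<And>t. t \<in> V \<Longrightarrow> f (t ^ n, \<phi> t) = 0"
proof -
  have n: "n > 0" and \<phi>: "\<phi> analytic_on {0}" and f0: "\<forall>\<^sub>F t in nhds 0. f (t ^ n, \<phi> t) = 0"
    using root by (simp_all add: puiseux_root_def)
  define Z where "Z = {\<zeta>::complex. \<zeta> ^ n = 1} - {1}"
  have "finite Z" using n by (simp add: Z_def finite_roots_unity)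
  have "\<forall>\<^sub>F s in nhds 0. s \<noteq> 0 \<longrightarrow> \<phi> (\<zeta> * s) \<noteq> \<phi> s" if "\<zeta> \<in> Z" for \<zeta>
  proof -
    have "\<not> (\<forall>\<^sub>F s in nhds 0. \<phi> (\<zeta> * s) - \<phi> s = 0)"
      using puiseux_root_reduce[OF root, of \<zeta>] min that by (auto simp: Z_def)
    moreover have "(\<phi> \<circ> (\<lambda>s. \<zeta> * s)) analytic_on {0}"
      using \<phi> by (intro analytic_on_compose) (auto intro!: analytic_intros)
    then have "(\<lambda>s. \<phi> (\<zeta> * s) - \<phi> s) analytic_on {0}"
      using \<phi> by (auto simp: o_def intro!: analytic_intros)
    ultimately obtain k b where b: "b analytic_on {0}" "b 0 \<noteq> 0"
      and eq: "\<forall>\<^sub>F s in nhds 0. \<phi> (\<zeta> * s) - \<phi> s = s ^ k * b s"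
      using analytic_factor_order by metis
    have "\<forall>\<^sub>F s in nhds 0. b s \<noteq> 0"
      using tendsto_imp_eventually_ne[OF analytic_at_tendsto[OF b(1)] b(2)] .
    with eq show ?thesis by eventually_elim auto
  qed
  then have "\<forall>\<^sub>F s in nhds 0. \<forall>\<zeta>\<in>Z. s \<noteq> 0 \<longrightarrow> \<phi> (\<zeta> * s) \<noteq> \<phi> s"
    using \<open>finite Z\<close> by (intro eventually_ball_finite ballI)
  moreover have "\<forall>\<^sub>F s in nhds 0. \<phi> field_differentiable at s"
    using \<phi> by (simp add: analytic_at_iff_eventually)
  ultimately have "\<forall>\<^sub>F s in nhds 0. (\<forall>\<zeta>\<in>Z. s \<noteq> 0 \<longrightarrow> \<phi> (\<zeta> * s) \<noteq> \<phi> s) \<and>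
      \<phi> field_differentiable at s \<and> f (s ^ n, \<phi> s) = 0"
    using f0 by eventually_elim simp
  then obtain V where V: "open V" "0 \<in> V" "\<forall>s\<in>V. (\<forall>\<zeta>\<in>Z. s \<noteq> 0 \<longrightarrow> \<phi> (\<zeta> * s) \<noteq> \<phi> s) \<and>
      \<phi> field_differentiable at s \<and> f (s ^ n, \<phi> s) = 0"
    unfolding eventually_nhds by (elim exE conjE) (rule that)
  show thesis
  proof (rule that[OF V(1,2)])
    show "\<phi> holomorphic_on V"
      unfolding holomorphic_on_def
      by (rule ballI, rule field_differentiable_at_within) (use V(3) in blast)
    show "inj_on (\<lambda>t. (t ^ n, \<phi> t)) V"
    proof (rule inj_onI, rule ccontr)
      fix t s assume ts: "t \<in> V" "s \<in> V" "(t ^ n, \<phi> t) = (s ^ n, \<phi> s)" "t \<noteq> s"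
      have "s \<noteq> 0"
      proof
        assume "s = 0"
        with ts n have "t ^ n = 0" by (simp add: power_0_left)
        with ts(4) \<open>s = 0\<close> show False by simp
      qed
      with ts have "t / s \<in> Z" by (simp add: Z_def power_divide)
      with V(3) ts(2) \<open>s \<noteq> 0\<close> have "\<phi> (t / s * s) \<noteq> \<phi> s" by blast
      with ts(3) \<open>s \<noteq> 0\<close> show False by simp
    qed
  qed (use V(3) in blast)
qed

section \<open>Puiseux's theorem\<close>

theorem theorem1p3p7:
  fixes C :: "(complex \<times> complex) set"
  assumes "plane_curve_germ C"
    and "\<not> germ_subset 0 {(x, y). x = 0} C"
  shows "\<exists>(n::nat) (\<phi>::complex \<Rightarrow> complex).
           n > 0 \<and> \<phi> analytic_on {0} \<and> \<phi> 0 = 0 \<and>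
           parametric_equation (\<lambda>t. (t ^ n, \<phi> t)) C"
proof -
  obtain f where f: "holomorphic_germ2 f" "f 0 = 0" and C: "germ_eq 0 C (f -` {0})"
    using assms(1) unfolding plane_curve_germ_def by (elim exE conjE) (rule that)
  have C_iff: "\<forall>\<^sub>F p in nhds 0. p \<in> C \<longleftrightarrow> f p = 0"
    using C by (simp add: germ_eq_def)
  have "\<not> (\<forall>\<^sub>F y in nhds 0. f (0, y) = 0)"
  proof
    assume *: "\<forall>\<^sub>F y in nhds 0. f (0, y) = 0"
    have "filterlim snd (nhds (0::complex)) (nhds (0 :: complex \<times> complex))"
      using holomorphic_germ2_tendsto[OF holomorphic_germ2_snd] by simp
    from eventually_compose_filterlim[OF * this] C_iff
    have "\<forall>\<^sub>F p in nhds 0. p \<in> {(x, y). x = 0} \<longrightarrow> p \<in> C"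
      by eventually_elim auto
    with assms(2) show False by (simp add: germ_subset_def)
  qed
  moreover have "(\<lambda>y. f (0, y)) analytic_on {0}"
    using holomorphic_germ2_slice_snd[OF f(1)] by (rule eventually_nhds_x_imp_x)
  ultimately obtain m g where g: "g analytic_on {0}" "g 0 \<noteq> 0" "\<forall>\<^sub>F y in nhds 0. f (0, y) = y ^ m * g y"
    using analytic_factor_order by metis
  then have derivs: "k < m \<Longrightarrow> (deriv ^^ k) (\<lambda>y. f (0, y)) 0 = 0" "(deriv ^^ m) (\<lambda>y. f (0, y)) 0 = fact m * g 0" for k
    using higher_deriv_of_expansion[where r = g and \<phi> = "\<lambda>y. f (0, y)" and m = m and a = "\<lambda>_. 0"] by simp_all
  have "m > 0"
    using eventually_nhds_x_imp_x[OF g(3)] f(2) g(2) by (cases m) (auto simp: zero_prod_def)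
  then have ex: "\<exists>n \<psi>. puiseux_root f n \<psi>"
    using derivs g(2) by (intro newton_puiseux[OF f(1)]) auto
  define n where "n = (LEAST n. \<exists>\<psi>. puiseux_root f n \<psi>)"
  obtain \<phi> where \<phi>: "puiseux_root f n \<phi>"
    using LeastI_ex[OF ex, folded n_def] by (elim exE) (rule that)
  have min: "\<not> puiseux_root f n' \<xi>" if "n' < n" for n' \<xi>
    using not_less_Least[OF that[unfolded n_def]] by blast
  obtain V where V: "open V" "0 \<in> V" "\<phi> holomorphic_on V" "inj_on (\<lambda>t. (t ^ n, \<phi> t)) V"
    "\<And>t. t \<in> V \<Longrightarrow> f (t ^ n, \<phi> t) = 0"
    by (rule minimal_puiseux_root_inj[OF \<phi> min]) (assumption, rule that)
  have n: "n > 0" and \<phi>0: "\<phi> analytic_on {0}" "\<phi> 0 = 0"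
    using \<phi> by (simp_all add: puiseux_root_def)
  have "germ_subset 0 ((\<lambda>t. (t ^ n, \<phi> t)) ` V) C"
    unfolding germ_subset_def using C_iff by eventually_elim (use V(5) in auto)
  then have "parametric_equation (\<lambda>t. (t ^ n, \<phi> t)) C"
    unfolding parametric_equation_def using V n \<phi>0
    by (intro conjI exI[of _ V]) (auto simp: power_0_left zero_prod_def intro!: holomorphic_intros)
  with n \<phi>0 show ?thesis by (intro exI conjI)
qed

end
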